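(* Let $n\ge m\ge 4$. Then $\mathrm{f}\mu^{1}(C_m\,\square\,C_n)=6$ if $m=4$ and $n$ is odd; $=m$ if $m\ge 5$ and $n$ is odd; $=n$ if $m$ is odd and $n<2m$ is even; and $=2m$ in all other cases. Moreover, for $k\ge 2$ and $n\ge m\ge 4$: $\mathrm{f}\mu^{k}(C_m\,\square\,C_n)=4$ if $k=2$ and $m,n$ are both even; $=3$ if $k=2$ and exactly one of $m,n$ is even; $=2$ if $k=2$ and $m,n$ are both odd; and $=2$ if $k\ge 3$.
   Context: For an integer $k\ge 0$ and a connected graph $G$, a set $X\subseteq V(G)$ is a $k$-fault-tolerant mutual-visibility set ($k$-ftmv set) if for any two non-adjacent vertices $u,v\in X$ there exist $k+1$ internally vertex-disjoint shortest $u,v$-paths $Q_1,\dots,Q_{k+1}$ in $G$ such that $V(Q_i)\cap X=\{u,v\}$ for every $i$. $\mathrm{f}\mu^{k}(G)$ denotes the maximum cardinality of a $k$-ftmv set of $G$. $C_n$ is the cycle on $n$ vertices, and $G\,\square\,H$ is the Cartesian product: vertex set $V(G)\times V(H)$, with $(g,h)\sim(g',h')$ iff either $g=g'$ and $hh'\in E(H)$, or $gg'\in E(G)$ and $h=h'$. *)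

theory Defs
  imports Main
begin

(* Undirected graphs: an edge is the unordered pair of its end vertices. *)
record 'a graph =
  verts :: "'a set"
  edges :: "'a set set"

definition adjacent :: "'a graph \<Rightarrow> 'a \<Rightarrow> 'a \<Rightarrow> bool" where
  "adjacent G u v \<longleftrightarrow> {u, v} \<in> edges G"

(* A simple graph for n at least 3; for n = 1 the formula gives a loop, for n = 2 a single edge. *)
definition cycle_graph :: "nat \<Rightarrow> nat graph" where
  "cycle_graph n = \<lparr>verts = {0..<n}, edges = {{i, (i + 1) mod n} | i. i < n}\<rparr>"

definition cartesian_product :: "'a graph \<Rightarrow> 'b graph \<Rightarrow> ('a \<times> 'b) graph" where
  "cartesian_product G H =
     \<lparr>verts = verts G \<times> verts H,
      edges = {{(g, h), (g', h')} | g h g' h'.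
                 g \<in> verts G \<and> g' \<in> verts G \<and> h \<in> verts H \<and> h' \<in> verts H \<and>
                 ((g = g' \<and> adjacent H h h') \<or> (adjacent G g g' \<and> h = h'))}\<rparr>"

(* A path is given by the list of its vertices in order of traversal. *)
definition is_path :: "'a graph \<Rightarrow> 'a \<Rightarrow> 'a \<Rightarrow> 'a list \<Rightarrow> bool" where
  "is_path G u v p \<longleftrightarrow>
     p \<noteq> [] \<and> hd p = u \<and> last p = v \<and> set p \<subseteq> verts G \<and> distinct p \<and>
     successively (adjacent G) p"

(* Lists count vertices rather than edges, which does not affect minimality. *)
definition is_shortest_path :: "'a graph \<Rightarrow> 'a \<Rightarrow> 'a \<Rightarrow> 'a list \<Rightarrow> bool" where
  "is_shortest_path G u v p \<longleftrightarrow>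
     is_path G u v p \<and> (\<forall>q. is_path G u v q \<longrightarrow> length p \<le> length q)"

definition internally_disjoint :: "'a \<Rightarrow> 'a \<Rightarrow> 'a list \<Rightarrow> 'a list \<Rightarrow> bool" where
  "internally_disjoint u v p q \<longleftrightarrow> (set p - {u, v}) \<inter> (set q - {u, v}) = {}"

(* u and v are distinct and non-adjacent, so every path Q i has an internal vertex and
   internal disjointness forces the k + 1 paths to be pairwise different. *)
definition ftmv_set :: "nat \<Rightarrow> 'a graph \<Rightarrow> 'a set \<Rightarrow> bool" where
  "ftmv_set k G X \<longleftrightarrow>
     X \<subseteq> verts G \<and>
     (\<forall>u\<in>X. \<forall>v\<in>X. u \<noteq> v \<and> \<not> adjacent G u v \<longrightarrow>
       (\<exists>Q :: nat \<Rightarrow> 'a list.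
          (\<forall>i\<in>{1..k+1}. is_shortest_path G u v (Q i) \<and> set (Q i) \<inter> X = {u, v}) \<and>
          (\<forall>i\<in>{1..k+1}. \<forall>j\<in>{1..k+1}. i \<noteq> j \<longrightarrow> internally_disjoint u v (Q i) (Q j))))"

(* Intended for finite graphs, where the maximum ranges over a finite set containing 0. *)
definition ftmv_number :: "nat \<Rightarrow> 'a graph \<Rightarrow> nat" where
  "ftmv_number k G = Max {card X | X. ftmv_set k G X}"

end

theory Submission
  imports Defs
begin

text \<open>The distance on the torus is the sum of the two cycle distances, and a shortest path is a
  walk of the right length. Upper bounds: \<open>k + 1\<close> disjoint shortest \<open>u\<close>,\<open>v\<close>-paths avoiding
  \<open>X\<close> need \<open>k + 1\<close> neighbours of \<open>u\<close> outside \<open>X\<close> that are closer to \<open>v\<close>, and each cycle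
  provides at most one of them, or two if the coordinates of \<open>u\<close> and \<open>v\<close> in it are antipodal. So for
  \<open>k = 1\<close> two vertices in the same column are adjacent or antipodal; for odd \<open>n\<close> they are
  adjacent, and then all remaining vertices lie in the antipodal column or in the one row
  equidistant from both. Lower bounds: if \<open>X\<close> meets each row and column only in antipodal
  vertices, then the two boundary paths of the rectangle spanned by \<open>u\<close> and \<open>v\<close> avoid \<open>X\<close>;
  only pairs that are antipodal in both coordinates, and the case \<open>m = 4\<close>, need other paths.\<close>

section \<open>Graphs with a distance function\<close>

text \<open>For \<open>k = 1\<close> and n = 2h a column can hold an antipodal pair of rows, and
  there are h such pairs. Giving different columns different pairs yields 2 * min(m, h) vertices: 2m
  if n >= 2m, and n otherwise, which is optimal for odd m by the odd-cycle bound with the factors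
  exchanged. If m is even, two antipodal columns may share a pair, so m/2 <= h suffices for 2m. The
  price is a pair of vertices antipodal in both coordinates whose rectangle has its other two
  corners in the set; the paths must then turn inside the rectangle, which is done for m >= 6. For m
  = 4, and for \<open>k = 2\<close>, the sets come from an edge of the n-cycle and what lies
  opposite to it: an edge for even n, a single vertex for odd n. This explains 8 against 6 and, for
  even m, 4 against 3. For \<open>k \<ge> 2\<close> antipodality says nothing about adjacent
  vertices of the set; they are controlled because distinct non-adjacent ones have distance at least
  3 and the torus has no triangles, so that the edges inside the set form a matching.\<close>

definition linked :: "nat \<Rightarrow> 'a graph \<Rightarrow> 'a set \<Rightarrow> 'a \<Rightarrow> 'a \<Rightarrow> bool" where
  "linked k G X u v \<longleftrightarrow>
     (\<exists>Q :: nat \<Rightarrow> 'a list.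
        (\<forall>i\<in>{1..k+1}. is_shortest_path G u v (Q i) \<and> set (Q i) \<inter> X = {u, v}) \<and>
        (\<forall>i\<in>{1..k+1}. \<forall>j\<in>{1..k+1}. i \<noteq> j \<longrightarrow> internally_disjoint u v (Q i) (Q j)))"

lemma ftmv_set_iff_linked:
  "ftmv_set k G X \<longleftrightarrow>
     X \<subseteq> verts G \<and> (\<forall>u\<in>X. \<forall>v\<in>X. u \<noteq> v \<and> \<not> adjacent G u v \<longrightarrow> linked k G X u v)"
  by (simp add: ftmv_set_def linked_def)

lemma ftmv_number_eqI:
  assumes "ftmv_set k G X" "card X = N" "\<And>Y. ftmv_set k G Y \<Longrightarrow> card Y \<le> N"
  shows "ftmv_number k G = N"
  unfolding ftmv_number_def
proof (rule Max_eqI)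
  have "{card Y | Y. ftmv_set k G Y} \<subseteq> {..N}" using assms(3) by auto
  then show "finite {card Y | Y. ftmv_set k G Y}" by (rule finite_subset) simp
qed (use assms in auto)

lemma adjacent_commute: "adjacent G u v \<longleftrightarrow> adjacent G v u"
  by (simp add: adjacent_def insert_commute)

lemma successively_adjacent_rev:
  "successively (adjacent G) (rev p) \<longleftrightarrow> successively (adjacent G) p"
  unfolding successively_rev by (simp only: adjacent_commute[of G])

text \<open>Distinctness is dropped from \<open>is_path\<close> so that walks can be concatenated
  freely. By \<open>tight_walk_distinct\<close> it comes back as soon as the length is
  minimal.\<close>

definition walk :: "'a graph \<Rightarrow> 'a \<Rightarrow> 'a \<Rightarrow> 'a list \<Rightarrow> bool" where
  "walk G u v p \<longleftrightarrow>
     p \<noteq> [] \<and> hd p = u \<and> last p = v \<and> set p \<subseteq> verts G \<and> successively (adjacent G) p"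

lemma is_path_iff_walk: "is_path G u v p \<longleftrightarrow> walk G u v p \<and> distinct p"
  by (auto simp: is_path_def walk_def)

lemma walk_single: "walk G u v [x] \<longleftrightarrow> x = u \<and> x = v \<and> u \<in> verts G"
  by (auto simp: walk_def)

lemma walk_Cons:
  assumes "q \<noteq> []"
  shows "walk G u v (x # q) \<longleftrightarrow> x = u \<and> u \<in> verts G \<and> adjacent G u (hd q) \<and> walk G (hd q) v q"
  using assms by (cases q) (auto simp: walk_def)

lemma walk_rev: "walk G u v p \<Longrightarrow> walk G v u (rev p)"
  by (auto simp: walk_def hd_rev last_rev successively_adjacent_rev simp del: successively_rev)

lemma walk_append:
  assumes "walk G u w p" "walk G w v q"
  shows "walk G u v (p @ tl q)" "set (p @ tl q) = set p \<union> set q"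
proof -
  obtain q' where q: "q = w # q'" using assms(2) by (cases q) (auto simp: walk_def)
  show "walk G u v (p @ tl q)"
    using assms q by (cases q') (auto simp: walk_def successively_append_iff)
  show "set (p @ tl q) = set p \<union> set q"
    using assms q by (auto simp: walk_def)
qed

lemma walk_map:
  assumes "walk G u v p" "f ` verts G \<subseteq> verts H"
    "\<And>x y. adjacent G x y \<Longrightarrow> x \<in> verts G \<Longrightarrow> y \<in> verts G \<Longrightarrow> adjacent H (f x) (f y)"
  shows "walk H (f u) (f v) (map f p)"
proof -
  have "successively (\<lambda>x y. adjacent H (f x) (f y)) p"
    by (rule successively_mono[of "adjacent G"]) (use assms in \<open>auto simp: walk_def subset_iff\<close>)
  then show ?thesis using assms(1,2)
    by (auto simp: walk_def successively_map hd_map last_map)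
qed

text \<open>The assumptions determine \<open>d\<close> as the graph distance without mentioning
  paths: \<open>dist_step\<close> bounds every walk from below, and \<open>dist_descent\<close>
  produces a walk attaining the bound. In this form they pass to products by adding
  distances.\<close>

locale metric_graph =
  fixes G :: "'a graph" and d :: "'a \<Rightarrow> 'a \<Rightarrow> nat"
  assumes adjacent_verts: "adjacent G u v \<Longrightarrow> u \<in> verts G \<and> v \<in> verts G"
    and dist_eq_0: "u \<in> verts G \<Longrightarrow> v \<in> verts G \<Longrightarrow> d u v = 0 \<longleftrightarrow> u = v"
    and dist_commute: "d u v = d v u"
    and dist_step: "adjacent G u w \<Longrightarrow> v \<in> verts G \<Longrightarrow> d u v \<le> Suc (d w v)"
    and dist_descent: "u \<in> verts G \<Longrightarrow> v \<in> verts G \<Longrightarrow> u \<noteq> v \<Longrightarrow>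
      \<exists>w. adjacent G u w \<and> d u v = Suc (d w v)"
begin

lemma walk_length: "walk G u v p \<Longrightarrow> Suc (d u v) \<le> length p"
proof (induction p arbitrary: u)
  case Nil
  then show ?case by (simp add: walk_def)
next
  case (Cons x q)
  show ?case
  proof (cases "q = []")
    case True
    with Cons.prems have "u = v" "u \<in> verts G" by (auto simp: walk_single)
    then show ?thesis using dist_eq_0[of u v] by simp
  next
    case False
    then have q: "adjacent G u (hd q)" "walk G (hd q) v q"
      using Cons.prems by (auto simp: walk_Cons)
    then have "v \<in> verts G" by (auto simp: walk_def)
    with q show ?thesis using Cons.IH[of "hd q"] dist_step[of u "hd q" v] by simp
  qed
qed

text \<open>Each step of a tight walk lowers the distance to \<open>v\<close> by exactly one, so the
  tail stays strictly closer to \<open>v\<close> than \<open>u\<close> is and cannot return to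
  \<open>u\<close>. The distance bound is carried through the induction for this reason.\<close>

lemma tight_walk_distinct:
  "walk G u v p \<Longrightarrow> length p = Suc (d u v) \<Longrightarrow> distinct p \<and> (\<forall>x\<in>set p. d x v \<le> d u v)"
proof (induction p arbitrary: u)
  case Nil
  then show ?case by simp
next
  case (Cons x q)
  show ?case
  proof (cases "q = []")
    case True
    then show ?thesis using Cons.prems by (auto simp: walk_single)
  next
    case False
    then have q: "x = u" "adjacent G u (hd q)" "walk G (hd q) v q"
      using Cons.prems by (auto simp: walk_Cons)
    then have "v \<in> verts G" by (auto simp: walk_def)
    then have "d u v \<le> Suc (d (hd q) v)" using q dist_step by blast
    moreover have "Suc (d (hd q) v) \<le> length q" using q walk_length by blast
    moreover have "length q = d u v" using Cons.prems by simp
    ultimately have "length q = Suc (d (hd q) v)" by simp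
    then show ?thesis using Cons.IH[OF q(3)] q(1) \<open>length q = d u v\<close> by fastforce
  qed
qed

lemma tight_walk_exists:
  "u \<in> verts G \<Longrightarrow> v \<in> verts G \<Longrightarrow> \<exists>p. walk G u v p \<and> length p = Suc (d u v)"
proof (induction "d u v" arbitrary: u)
  case 0
  then have "walk G u v [u]" using dist_eq_0 by (simp add: walk_single)
  then show ?case using 0 by force
next
  case (Suc k)
  then have "u \<noteq> v" using dist_eq_0[of u v] by auto
  then obtain w where w: "adjacent G u w" "d u v = Suc (d w v)"
    using dist_descent Suc.prems by blast
  then have "w \<in> verts G" using adjacent_verts by blast
  then obtain p where p: "walk G w v p" "length p = Suc (d w v)"
    using Suc w by auto
  then have "p \<noteq> []" "hd p = w" by (auto simp: walk_def)
  with p w Suc.prems have "walk G u v (u # p)" by (simp add: walk_Cons)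
  then show ?case using p w by (intro exI[of _ "u # p"]) simp
qed

lemma is_shortest_path_iff:
  assumes "u \<in> verts G" "v \<in> verts G"
  shows "is_shortest_path G u v p \<longleftrightarrow> walk G u v p \<and> length p = Suc (d u v)"
proof
  assume p: "is_shortest_path G u v p"
  then have "walk G u v p" by (simp add: is_shortest_path_def is_path_iff_walk)
  moreover obtain q where q: "walk G u v q" "length q = Suc (d u v)"
    using tight_walk_exists assms by blast
  then have "is_path G u v q" using tight_walk_distinct by (simp add: is_path_iff_walk)
  then have "length p \<le> Suc (d u v)" using p q by (auto simp: is_shortest_path_def)
  ultimately show "walk G u v p \<and> length p = Suc (d u v)" using walk_length[of u v p] by simp
next
  assume "walk G u v p \<and> length p = Suc (d u v)"
  then show "is_shortest_path G u v p"
    using tight_walk_distinct walk_length by (auto simp: is_shortest_path_def is_path_iff_walk)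
qed

text \<open>Avoiding \<open>X\<close> and disjointness depend only on the vertices of a path, so a
  shortest path is represented by its vertex set. Reversal then changes nothing and concatenation
  becomes union.\<close>

definition geodesic :: "'a \<Rightarrow> 'a \<Rightarrow> 'a set \<Rightarrow> bool" where
  "geodesic u v S \<longleftrightarrow> (\<exists>p. walk G u v p \<and> length p = Suc (d u v) \<and> set p = S)"

lemma geodesic_exists: "u \<in> verts G \<Longrightarrow> v \<in> verts G \<Longrightarrow> \<exists>S. geodesic u v S"
  using tight_walk_exists by (auto simp: geodesic_def)

lemma geodesic_ends:
  assumes "geodesic u v S"
  shows "u \<in> S" "v \<in> S" "S \<subseteq> verts G"
  using assms by (auto simp: geodesic_def walk_def)

lemma geodesic_commute: "geodesic u v S \<Longrightarrow> geodesic v u S"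
proof -
  assume "geodesic u v S"
  then obtain p where "walk G u v p" "length p = Suc (d u v)" "set p = S"
    by (auto simp: geodesic_def)
  then show ?thesis unfolding geodesic_def
    by (intro exI[of _ "rev p"]) (simp add: walk_rev dist_commute)
qed

lemma geodesic_trans:
  assumes "geodesic u w S" "geodesic w v T" "d u w + d w v = d u v"
  shows "geodesic u v (S \<union> T)"
proof -
  obtain p q where pq: "walk G u w p" "length p = Suc (d u w)" "set p = S"
    "walk G w v q" "length q = Suc (d w v)" "set q = T"
    using assms by (auto simp: geodesic_def)
  then have "length (p @ tl q) = Suc (d u v)" using assms(3) by simp
  then show ?thesis using walk_append[OF pq(1,4)] pq unfolding geodesic_def by blast
qed

lemma geodesic_between:
  assumes "geodesic u v S" "w \<in> S"
  shows "d u w + d w v \<le> d u v"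
proof -
  obtain p where p: "walk G u v p" "length p = Suc (d u v)" "set p = S"
    using assms by (auto simp: geodesic_def)
  then obtain a b where ab: "p = a @ w # b" using assms(2) by (auto dest: split_list)
  have "walk G u w (a @ [w])" "walk G w v (w # b)"
    using p ab by (auto simp: walk_def successively_append_iff hd_append split: if_splits)
  then show ?thesis using walk_length[of u w "a @ [w]"] walk_length[of w v "w # b"] p(2) ab by simp
qed

lemma geodesic_single: "u \<in> verts G \<Longrightarrow> geodesic u u {u}"
  unfolding geodesic_def using dist_eq_0[of u u] by (intro exI[of _ "[u]"]) (simp add: walk_single)

lemma geodesic_edge:
  assumes "adjacent G u v" "u \<noteq> v"
  shows "geodesic u v {u, v}"
proof -
  have uv: "u \<in> verts G" "v \<in> verts G" using assms adjacent_verts by auto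
  then have "walk G u v [u, v]" using assms by (simp add: walk_def)
  moreover from this have "Suc (d u v) \<le> 2" using walk_length by fastforce
  then have "d u v = 1" using dist_eq_0[of u v] uv assms(2) by simp
  ultimately show ?thesis unfolding geodesic_def by (intro exI[of _ "[u, v]"]) simp
qed

lemma linkedI:
  assumes S: "\<And>i. i \<le> k \<Longrightarrow> geodesic u v (S i)"
    and X: "u \<in> X" "v \<in> X" "\<And>i. i \<le> k \<Longrightarrow> S i \<inter> X \<subseteq> {u, v}"
    and disj: "\<And>i j. i < j \<Longrightarrow> j \<le> k \<Longrightarrow> S i \<inter> S j \<subseteq> {u, v}"
  shows "linked k G X u v"
proof -
  obtain P where P: "\<And>i. i \<le> k \<Longrightarrow> walk G u v (P i) \<and> length (P i) = Suc (d u v) \<and> set (P i) = S i"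
    using S unfolding geodesic_def by metis
  have uv: "u \<in> verts G" "v \<in> verts G" using geodesic_ends[OF S[of 0]] by auto
  have *: "S i \<inter> S j \<subseteq> {u, v}" if "i \<le> k" "j \<le> k" "i \<noteq> j" for i j
    using disj[of i j] disj[of j i] that by (cases "i < j") auto
  show ?thesis unfolding linked_def
  proof (intro exI[of _ "\<lambda>i. P (i - 1)"] conjI ballI impI)
    fix i assume i: "i \<in> {1..k+1}"
    then have P': "walk G u v (P (i - 1)) \<and> length (P (i - 1)) = Suc (d u v) \<and> set (P (i - 1)) = S (i - 1)"
      using P[of "i - 1"] by auto
    then show "is_shortest_path G u v (P (i - 1))" using is_shortest_path_iff[OF uv] by simp
    have "i - 1 \<le> k" using i by auto
    then show "set (P (i - 1)) \<inter> X = {u, v}"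
      using P' X(3)[of "i - 1"] X(1,2) geodesic_ends[OF S[of "i - 1"]] by auto
    fix j assume j: "j \<in> {1..k+1}" "i \<noteq> j"
    then have "set (P (j - 1)) = S (j - 1)" using P[of "j - 1"] by auto
    moreover have "S (i - 1) \<inter> S (j - 1) \<subseteq> {u, v}" using i j by (intro *) auto
    ultimately show "internally_disjoint u v (P (i - 1)) (P (j - 1))"
      using P' by (auto simp: internally_disjoint_def)
  qed
qed

lemma linked_1I:
  assumes "geodesic u v S" "geodesic u v T" "u \<in> X" "v \<in> X"
    "S \<inter> X \<subseteq> {u, v}" "T \<inter> X \<subseteq> {u, v}" "S \<inter> T \<subseteq> {u, v}"
  shows "linked 1 G X u v"
  using assms by (intro linkedI[of 1 u v "\<lambda>i. if i = 0 then S else T"]) auto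

lemma linked_2I:
  assumes "geodesic u v S" "geodesic u v T" "geodesic u v R" "u \<in> X" "v \<in> X"
    "S \<inter> X \<subseteq> {u, v}" "T \<inter> X \<subseteq> {u, v}" "R \<inter> X \<subseteq> {u, v}"
    "S \<inter> T \<subseteq> {u, v}" "S \<inter> R \<subseteq> {u, v}" "T \<inter> R \<subseteq> {u, v}"
  shows "linked 2 G X u v"
  using assms
  by (intro linkedI[of 2 u v "\<lambda>i. if i = 0 then S else if i = 1 then T else R"]) auto

lemma linked_commute:
  assumes "linked k G X u v" "u \<in> verts G" "v \<in> verts G"
  shows "linked k G X v u"
proof -
  obtain Q where Q: "\<forall>i\<in>{1..k+1}. is_shortest_path G u v (Q i) \<and> set (Q i) \<inter> X = {u, v}"
    "\<forall>i\<in>{1..k+1}. \<forall>j\<in>{1..k+1}. i \<noteq> j \<longrightarrow> internally_disjoint u v (Q i) (Q j)"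
    using assms(1) by (auto simp: linked_def)
  show ?thesis unfolding linked_def
    using Q assms(2,3)
    by (intro exI[of _ "\<lambda>i. rev (Q i)"])
      (auto simp: is_shortest_path_iff walk_rev dist_commute internally_disjoint_def insert_commute)
qed

text \<open>The second vertex of each path is internal because \<open>u\<close> and \<open>v\<close>
  are not adjacent. Hence it lies outside \<open>X\<close>, and disjointness makes these vertices
  different for different paths.\<close>

lemma linked_closer_neighbours:
  assumes "linked k G X u v" "u \<in> verts G" "v \<in> verts G" "u \<noteq> v" "\<not> adjacent G u v"
  obtains W where "card W = Suc k" "\<And>w. w \<in> W \<Longrightarrow> adjacent G u w \<and> w \<notin> X \<and> d w v < d u v"
proof -
  obtain Q where Q: "\<And>i. i \<in> {1..k+1} \<Longrightarrow> is_shortest_path G u v (Q i) \<and> set (Q i) \<inter> X = {u, v}"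
    "\<And>i j. i \<in> {1..k+1} \<Longrightarrow> j \<in> {1..k+1} \<Longrightarrow> i \<noteq> j \<Longrightarrow> internally_disjoint u v (Q i) (Q j)"
    using assms(1) unfolding linked_def by blast
  define w where "w i = hd (tl (Q i))" for i
  have w: "adjacent G u (w i) \<and> w i \<notin> X \<and> d (w i) v < d u v \<and> w i \<in> set (Q i) - {u, v}"
    if i: "i \<in> {1..k+1}" for i
  proof -
    have Qi: "walk G u v (Q i)" "length (Q i) = Suc (d u v)" "set (Q i) \<inter> X = {u, v}"
      using Q(1)[OF i] is_shortest_path_iff assms by auto
    then have dis: "distinct (Q i)" using tight_walk_distinct by blast
    obtain q where q: "Q i = u # q" using Qi(1) by (cases "Q i") (auto simp: walk_def)
    have "q \<noteq> []" using Qi(1) q assms(4) by (auto simp: walk_def)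
    then have "adjacent G u (hd q)" "walk G (hd q) v q" using Qi(1) q by (auto simp: walk_Cons)
    moreover from this have "d (hd q) v < d u v" using Qi(2) q walk_length by fastforce
    moreover have "hd q \<noteq> u" "hd q \<in> set q" using dis q \<open>q \<noteq> []\<close> by (auto simp: neq_Nil_conv)
    moreover have "hd q \<noteq> v" using \<open>adjacent G u (hd q)\<close> assms(5) by auto
    ultimately show ?thesis using Qi(3) q unfolding w_def by auto
  qed
  have "inj_on w {1..k+1}"
  proof (rule inj_onI, rule ccontr)
    fix i j assume ij: "i \<in> {1..k+1}" "j \<in> {1..k+1}" "w i = w j" "i \<noteq> j"
    then show False using Q(2)[OF ij(1,2,4)] w[OF ij(1)] w[OF ij(2)]
      by (auto simp: internally_disjoint_def)
  qed
  then have "card (w ` {1..k+1}) = Suc k" by (simp add: card_image)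
  then show thesis using that[of "w ` {1..k+1}"] w by blast
qed

end

section \<open>Isomorphisms and Cartesian products\<close>

lemma is_path_map:
  assumes "is_path G u v p" "inj_on f (verts G)" "f ` verts G \<subseteq> verts H"
    "\<And>x y. x \<in> verts G \<Longrightarrow> y \<in> verts G \<Longrightarrow> adjacent G x y \<Longrightarrow> adjacent H (f x) (f y)"
  shows "is_path H (f u) (f v) (map f p)"
proof -
  have "set p \<subseteq> verts G" using assms(1) by (simp add: is_path_def)
  then show ?thesis using assms
    by (auto simp: is_path_iff_walk distinct_map walk_map intro: inj_on_subset)
qed

definition graph_iso :: "('a \<Rightarrow> 'b) \<Rightarrow> 'a graph \<Rightarrow> 'b graph \<Rightarrow> bool" where
  "graph_iso f G H \<longleftrightarrow> bij_betw f (verts G) (verts H) \<and>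
     (\<forall>x\<in>verts G. \<forall>y\<in>verts G. adjacent H (f x) (f y) \<longleftrightarrow> adjacent G x y)"

lemma is_shortest_path_iso:
  assumes f: "graph_iso f G H" and p: "is_shortest_path G u v p"
  shows "is_shortest_path H (f u) (f v) (map f p)"
proof -
  define g where "g = the_inv_into (verts G) f"
  have bij: "bij_betw f (verts G) (verts H)" and inj: "inj_on f (verts G)"
    and adj: "\<And>x y. x \<in> verts G \<Longrightarrow> y \<in> verts G \<Longrightarrow> adjacent H (f x) (f y) \<longleftrightarrow> adjacent G x y"
    using f by (auto simp: graph_iso_def bij_betw_def)
  have gbij: "bij_betw g (verts H) (verts G)"
    unfolding g_def using bij by (rule bij_betw_the_inv_into)
  have fg: "f (g y) = y" if "y \<in> verts H" for y
    unfolding g_def using bij that by (simp add: f_the_inv_into_f_bij_betw)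
  have gf: "g (f x) = x" if "x \<in> verts G" for x
    unfolding g_def using inj that by (simp add: the_inv_into_f_f)
  have gv: "g y \<in> verts G" if "y \<in> verts H" for y using gbij that by (auto simp: bij_betw_def)
  have path: "is_path G u v p" using p by (simp add: is_shortest_path_def)
  then have uv: "u \<in> verts G" "v \<in> verts G" by (auto simp: is_path_iff_walk walk_def)
  have "is_path H (f u) (f v) (map f p)"
    by (rule is_path_map[OF path]) (use bij adj in \<open>auto simp: bij_betw_def\<close>)
  moreover have "length p \<le> length q" if q: "is_path H (f u) (f v) q" for q
  proof -
    have "is_path G (g (f u)) (g (f v)) (map g q)"
    proof (rule is_path_map[OF q])
      fix x y assume xy: "x \<in> verts H" "y \<in> verts H" "adjacent H x y"
      then have "adjacent H (f (g x)) (f (g y))" by (simp add: fg)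
      then show "adjacent G (g x) (g y)" using adj gv xy by blast
    qed (use gbij in \<open>auto simp: bij_betw_def\<close>)
    then show ?thesis using p uv by (auto simp: gf is_shortest_path_def)
  qed
  ultimately show ?thesis by (simp add: is_shortest_path_def)
qed

lemma linked_iso:
  assumes f: "graph_iso f G H" and X: "X \<subseteq> verts G" "u \<in> X" "v \<in> X" and "linked k G X u v"
  shows "linked k H (f ` X) (f u) (f v)"
proof -
  have inj: "inj_on f (verts G)" using f by (auto simp: graph_iso_def bij_betw_def)
  obtain Q where Q: "\<forall>i\<in>{1..k+1}. is_shortest_path G u v (Q i) \<and> set (Q i) \<inter> X = {u, v}"
    "\<forall>i\<in>{1..k+1}. \<forall>j\<in>{1..k+1}. i \<noteq> j \<longrightarrow> internally_disjoint u v (Q i) (Q j)"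
    using assms(5) by (auto simp: linked_def)
  have V: "set (Q i) \<subseteq> verts G" if "i \<in> {1..k+1}" for i
    using Q(1) that by (auto simp: is_shortest_path_def is_path_def)
  show ?thesis unfolding linked_def
  proof (intro exI[of _ "\<lambda>i. map f (Q i)"] conjI ballI impI)
    fix i assume i: "i \<in> {1..k+1}"
    then show "is_shortest_path H (f u) (f v) (map f (Q i))"
      using Q(1) is_shortest_path_iso[OF f] by blast
    have "f ` set (Q i) \<inter> f ` X = f ` (set (Q i) \<inter> X)"
      using inj_on_image_Int[OF inj V[OF i] X(1)] by simp
    then show "set (map f (Q i)) \<inter> f ` X = {f u, f v}" using Q(1) i by auto
    fix j assume j: "j \<in> {1..k+1}" "i \<noteq> j"
    have "f ` set (Q i) \<inter> f ` set (Q j) = f ` (set (Q i) \<inter> set (Q j))"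
      using inj_on_image_Int[OF inj V[OF i] V[OF j(1)]] by simp
    moreover have "internally_disjoint u v (Q i) (Q j)" using Q(2) i j by blast
    then have "set (Q i) \<inter> set (Q j) \<subseteq> {u, v}" by (auto simp: internally_disjoint_def)
    ultimately show "internally_disjoint (f u) (f v) (map f (Q i)) (map f (Q j))"
      by (auto simp: internally_disjoint_def)
  qed
qed

lemma ftmv_set_iso:
  assumes f: "graph_iso f G H" and X: "ftmv_set k G X"
  shows "ftmv_set k H (f ` X)" "card (f ` X) = card X"
proof -
  have V: "X \<subseteq> verts G" using X by (simp add: ftmv_set_iff_linked)
  show "ftmv_set k H (f ` X)" unfolding ftmv_set_iff_linked
  proof (intro conjI ballI impI)
    show "f ` X \<subseteq> verts H" using V f by (auto simp: graph_iso_def bij_betw_def)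
    fix a b assume "a \<in> f ` X" "b \<in> f ` X" and ab: "a \<noteq> b \<and> \<not> adjacent H a b"
    then obtain u v where uv: "u \<in> X" "v \<in> X" "a = f u" "b = f v" by auto
    then have "u \<noteq> v \<and> \<not> adjacent G u v" using ab f V by (auto simp: graph_iso_def)
    then show "linked k H (f ` X) a b"
      using linked_iso[OF f V uv(1,2)] uv X by (auto simp: ftmv_set_iff_linked)
  qed
  show "card (f ` X) = card X"
    using f V by (meson bij_betw_def card_image graph_iso_def inj_on_subset)
qed

lemma verts_cartesian_product: "verts (cartesian_product G H) = verts G \<times> verts H"
  by (simp add: cartesian_product_def)

lemma adjacent_cartesian_product:
  "adjacent (cartesian_product G H) (g, h) (g', h') \<longleftrightarrow>
     g \<in> verts G \<and> g' \<in> verts G \<and> h \<in> verts H \<and> h' \<in> verts H \<and>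
     ((g = g' \<and> adjacent H h h') \<or> (adjacent G g g' \<and> h = h'))"
proof -
  define R where "R a b a' b' \<longleftrightarrow> a \<in> verts G \<and> a' \<in> verts G \<and> b \<in> verts H \<and> b' \<in> verts H \<and>
     ((a = a' \<and> adjacent H b b') \<or> (adjacent G a a' \<and> b = b'))" for a b a' b'
  have "R a b a' b' \<longleftrightarrow> R a' b' a b" for a b a' b'
    unfolding R_def using adjacent_commute by metis
  moreover have "adjacent (cartesian_product G H) (g, h) (g', h') \<longleftrightarrow>
      (\<exists>a b a' b'. {(g, h), (g', h')} = {(a, b), (a', b')} \<and> R a b a' b')"
    unfolding adjacent_def[of "cartesian_product G H"] R_def by (simp add: cartesian_product_def)
  ultimately show ?thesis unfolding R_def[symmetric] by (auto simp: doubleton_eq_iff)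
qed

lemma graph_iso_swap: "graph_iso prod.swap (cartesian_product G H) (cartesian_product H G)"
  unfolding graph_iso_def
  by (auto simp: verts_cartesian_product adjacent_cartesian_product bij_betw_def product_swap)

lemma ftmv_number_swap:
  "ftmv_number k (cartesian_product G H) = ftmv_number k (cartesian_product H G)"
proof -
  have "{card X | X. ftmv_set k (cartesian_product G H) X}
      \<subseteq> {card X | X. ftmv_set k (cartesian_product H G) X}" for G :: "'a graph" and H :: "'b graph"
    using ftmv_set_iso[OF graph_iso_swap] by (smt (verit) Collect_mono)
  moreover have "{card X | X. ftmv_set k (cartesian_product H G) X}
      \<subseteq> {card X | X. ftmv_set k (cartesian_product G H) X}"
    using ftmv_set_iso[OF graph_iso_swap] by (smt (verit) Collect_mono)
  ultimately have "{card X | X. ftmv_set k (cartesian_product G H) X}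
      = {card X | X. ftmv_set k (cartesian_product H G) X}" by blast
  then show ?thesis by (simp add: ftmv_number_def)
qed

lemma graph_iso_product:
  assumes "graph_iso f H H'"
  shows "graph_iso (\<lambda>(g, h). (g, f h)) (cartesian_product G H) (cartesian_product G H')"
proof -
  have f: "inj_on f (verts H)" "f ` verts H = verts H'"
    using assms by (auto simp: graph_iso_def bij_betw_def)
  have "(\<lambda>(g, h). (g, f h)) ` (verts G \<times> verts H) = verts G \<times> f ` verts H"
    by (auto intro!: image_eqI[where x = "(_, _)"])
  with f have "bij_betw (\<lambda>(g, h). (g, f h)) (verts G \<times> verts H) (verts G \<times> verts H')"
    by (auto simp: bij_betw_def inj_on_def)
  then show ?thesis using assms f
    by (auto simp: graph_iso_def verts_cartesian_product adjacent_cartesian_product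
        dest: inj_onD bij_betwE)
qed

locale two_metric_graphs =
  A: metric_graph G dG + B: metric_graph H dH
  for G :: "'a graph" and dG and H :: "'b graph" and dH
begin

abbreviation GH :: "('a \<times> 'b) graph" where "GH \<equiv> cartesian_product G H"

definition pdist :: "'a \<times> 'b \<Rightarrow> 'a \<times> 'b \<Rightarrow> nat" where
  "pdist u v = dG (fst u) (fst v) + dH (snd u) (snd v)"

lemma pdist_simp [simp]: "pdist (i, s) (j, t) = dG i j + dH s t"
  by (simp add: pdist_def)

lemma adjacent_GH:
  "adjacent GH (g, h) (g', h') \<longleftrightarrow>
     g = g' \<and> g \<in> verts G \<and> adjacent H h h' \<or> adjacent G g g' \<and> h = h' \<and> h \<in> verts H"
  using A.adjacent_verts B.adjacent_verts by (auto simp: adjacent_cartesian_product)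

sublocale P: metric_graph GH pdist
proof
  fix u v w :: "'a \<times> 'b"
  obtain g h g' h' x y where [simp]: "u = (g, h)" "v = (g', h')" "w = (x, y)" by (meson surj_pair)
  show "adjacent GH u v \<Longrightarrow> u \<in> verts GH \<and> v \<in> verts GH"
    by (auto simp: adjacent_cartesian_product verts_cartesian_product)
  show "u \<in> verts GH \<Longrightarrow> v \<in> verts GH \<Longrightarrow> pdist u v = 0 \<longleftrightarrow> u = v"
    by (auto simp: verts_cartesian_product A.dist_eq_0 B.dist_eq_0)
  show "pdist u v = pdist v u"
    by (simp add: A.dist_commute[of g] B.dist_commute[of h])
  show "adjacent GH u w \<Longrightarrow> v \<in> verts GH \<Longrightarrow> pdist u v \<le> Suc (pdist w v)"
    using A.dist_step[of g x g'] B.dist_step[of h y h']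
    by (auto simp: adjacent_GH verts_cartesian_product)
  assume uv: "u \<in> verts GH" "v \<in> verts GH" "u \<noteq> v"
  show "\<exists>w. adjacent GH u w \<and> pdist u v = Suc (pdist w v)"
  proof (cases "g = g'")
    case True
    then obtain b where "adjacent H h b" "dH h h' = Suc (dH b h')"
      using B.dist_descent uv by (auto simp: verts_cartesian_product)
    then show ?thesis using uv True
      by (intro exI[of _ "(g, b)"]) (auto simp: verts_cartesian_product adjacent_GH)
  next
    case False
    then obtain a where "adjacent G g a" "dG g g' = Suc (dG a g')"
      using A.dist_descent uv by (auto simp: verts_cartesian_product)
    then show ?thesis using uv
      by (intro exI[of _ "(a, h)"]) (auto simp: verts_cartesian_product adjacent_GH)
  qed
qed

lemma geodesic_row:
  assumes "A.geodesic i j S" "s \<in> verts H"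
  shows "P.geodesic (i, s) (j, s) (S \<times> {s})"
proof -
  obtain p where p: "walk G i j p" "length p = Suc (dG i j)" "set p = S"
    using assms by (auto simp: A.geodesic_def)
  have "walk GH (i, s) (j, s) (map (\<lambda>x. (x, s)) p)"
    using p(1) assms(2) by (intro walk_map) (auto simp: verts_cartesian_product adjacent_GH)
  then show ?thesis using p B.dist_eq_0 assms(2) unfolding P.geodesic_def
    by (intro exI[of _ "map (\<lambda>x. (x, s)) p"]) auto
qed

lemma geodesic_column:
  assumes "B.geodesic s t S" "i \<in> verts G"
  shows "P.geodesic (i, s) (i, t) ({i} \<times> S)"
proof -
  obtain p where p: "walk H s t p" "length p = Suc (dH s t)" "set p = S"
    using assms by (auto simp: B.geodesic_def)
  have "walk GH (i, s) (i, t) (map (\<lambda>x. (i, x)) p)"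
    using p(1) assms(2) by (intro walk_map) (auto simp: verts_cartesian_product adjacent_GH)
  then show ?thesis using p A.dist_eq_0 assms(2) unfolding P.geodesic_def
    by (intro exI[of _ "map (\<lambda>x. (i, x)) p"]) auto
qed

lemma geodesic_row_column:
  assumes "A.geodesic i j S" "B.geodesic s t T"
  shows "P.geodesic (i, s) (j, t) (S \<times> {s} \<union> {j} \<times> T)"
  using assms A.geodesic_ends[OF assms(1)] B.geodesic_ends[OF assms(2)]
    A.dist_eq_0 B.dist_eq_0
  by (intro P.geodesic_trans[OF geodesic_row geodesic_column]) auto

lemma geodesic_column_row:
  assumes "A.geodesic i j S" "B.geodesic s t T"
  shows "P.geodesic (i, s) (j, t) ({i} \<times> T \<union> S \<times> {t})"
  using assms A.geodesic_ends[OF assms(1)] B.geodesic_ends[OF assms(2)]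
    A.dist_eq_0 B.dist_eq_0
  by (intro P.geodesic_trans[OF geodesic_column geodesic_row]) auto

text \<open>The two paths turn at the opposite corners \<open>(j, s)\<close> and
  \<open>(i, t)\<close>. Their disjointness uses only that \<open>i\<close>, \<open>j\<close> and
  \<open>s\<close>, \<open>t\<close> differ, so each path may choose its own geodesic in each
  factor; \<open>geodesic_far\<close> later exploits this with different \<open>T\<close> and
  \<open>T'\<close>.\<close>

lemma linked_1_corners:
  assumes "A.geodesic i j S" "A.geodesic i j S'" "B.geodesic s t T" "B.geodesic s t T'"
    and "i \<noteq> j" "s \<noteq> t" and X: "(i, s) \<in> X" "(j, t) \<in> X"
    and "\<And>x. x \<in> S \<Longrightarrow> (x, s) \<in> X \<Longrightarrow> x = i" "\<And>y. y \<in> T \<Longrightarrow> (j, y) \<in> X \<Longrightarrow> y = t"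
    and "\<And>x. x \<in> S' \<Longrightarrow> (x, t) \<in> X \<Longrightarrow> x = j" "\<And>y. y \<in> T' \<Longrightarrow> (i, y) \<in> X \<Longrightarrow> y = s"
  shows "linked 1 GH X (i, s) (j, t)"
  using assms
  by (intro P.linked_1I[OF geodesic_row_column geodesic_column_row, of _ _ S _ _ T S' T']) auto

text \<open>Intended for antipodal \<open>i\<close>, \<open>j\<close> on a cycle: \<open>S\<close>
  and \<open>insert i S'\<close> are the two halves between them and \<open>c\<close> is the
  neighbour of \<open>i\<close> on the second half. Two paths go around the rectangle over
  \<open>S\<close>; the third steps to \<open>c\<close>, changes the second coordinate there, and
  follows \<open>S'\<close> to \<open>j\<close>. As \<open>X\<close> lies over \<open>i\<close> and
  \<open>j\<close>, the column of \<open>c\<close> is free.\<close>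

lemma linked_2_antipodal_rows:
  assumes S: "A.geodesic i j S" and S': "A.geodesic i j (insert i S')" "A.geodesic c j S'"
    and T: "B.geodesic s t T" "B.geodesic s t T'"
    and c: "adjacent G i c" "dG i j = Suc (dG c j)" "S \<inter> insert i S' \<subseteq> {i, j}" "c \<noteq> i" "i \<notin> S'" "c \<noteq> j"
    and ne: "i \<noteq> j" "s \<noteq> t" and X: "(i, s) \<in> X" "(j, t) \<in> X"
    and avoid: "fst ` X \<subseteq> {i, j}" "\<And>x. (x, s) \<in> X \<Longrightarrow> x = i" "\<And>x. (x, t) \<in> X \<Longrightarrow> x = j"
      "\<And>y. y \<in> T \<Longrightarrow> (j, y) \<in> X \<Longrightarrow> y = t" "\<And>y. y \<in> T' \<Longrightarrow> (i, y) \<in> X \<Longrightarrow> y = s"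
  shows "linked 2 GH X (i, s) (j, t)"
proof -
  have s: "s \<in> verts H" using B.geodesic_ends[OF T(1)] by auto
  have R2: "P.geodesic (c, s) (j, t) ({c} \<times> T \<union> S' \<times> {t})"
    using geodesic_column_row S'(2) T(1) by blast
  have R1: "P.geodesic (i, s) (c, s) {(i, s), (c, s)}"
    using c s by (intro P.geodesic_edge) (auto simp: adjacent_GH)
  \<comment> \<open>A tight walk with vertex set \<open>{i, c}\<close> repeats nothing, so it has
    two vertices.\<close>
  have "dG i c = 1"
  proof -
    have "A.geodesic i c {i, c}" using c by (intro A.geodesic_edge) auto
    then obtain p where "length p = Suc (dG i c)" "set p = {i, c}" "distinct p"
      using A.tight_walk_distinct unfolding A.geodesic_def by blast
    then show ?thesis using c(4) distinct_card[of p] by simp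
  qed
  then have R: "P.geodesic (i, s) (j, t) ({(i, s), (c, s)} \<union> ({c} \<times> T \<union> S' \<times> {t}))"
    using c(2) s B.dist_eq_0[of s s] by (intro P.geodesic_trans[OF R1 R2]) auto
  have cS: "c \<in> S'" "j \<in> S'" using A.geodesic_ends[OF S'(2)] by auto
  have "(c, y) \<notin> X" for y using avoid(1) c by force
  moreover have "c \<notin> S" using c cS by auto
  ultimately show ?thesis
    using c(3-6) ne cS avoid(2-5)
    by (intro P.linked_2I[OF geodesic_row_column[OF S T(1)] geodesic_column_row[OF S T(2)] R X]) blast+
qed

end

section \<open>Cycles\<close>

definition cyc_dist :: "nat \<Rightarrow> nat \<Rightarrow> nat \<Rightarrow> nat" where
  "cyc_dist n i j = (let k = (if i \<le> j then j - i else i - j) in min k (n - k))"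

lemma verts_cycle_graph [simp]: "verts (cycle_graph n) = {0..<n}"
  by (simp add: cycle_graph_def)

text \<open>With \<open>mod\<close> removed, adjacency becomes accessible to linear
  arithmetic.\<close>

lemma adjacent_cycle_graph:
  assumes "3 \<le> n"
  shows "adjacent (cycle_graph n) i j \<longleftrightarrow> i < n \<and> j < n \<and>
    (j = Suc i \<or> i = Suc j \<or> i = 0 \<and> Suc j = n \<or> j = 0 \<and> Suc i = n)"
proof -
  have "adjacent (cycle_graph n) i j \<longleftrightarrow>
      (\<exists>k<n. {i, j} = {k, if Suc k = n then 0 else Suc k})"
  proof -
    have "(k + 1) mod n = (if Suc k = n then 0 else Suc k)" if "k < n" for k
      using that by auto
    then have "{i, j} = {k, (k + 1) mod n} \<and> k < n \<longleftrightarrow>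
        k < n \<and> {i, j} = {k, if Suc k = n then 0 else Suc k}" for k
      by (cases "k < n") (simp_all only: simp_thms)
    then show ?thesis unfolding adjacent_def cycle_graph_def by simp
  qed
  also have "\<dots> \<longleftrightarrow> i < n \<and> j < n \<and>
    (j = Suc i \<or> i = Suc j \<or> i = 0 \<and> Suc j = n \<or> j = 0 \<and> Suc i = n)" (is "?L \<longleftrightarrow> ?R")
  proof
    assume ?L
    then obtain k where k: "k < n" "{i, j} = {k, if Suc k = n then 0 else Suc k}" by blast
    then show ?R using assms by (auto simp: doubleton_eq_iff split: if_splits)
  next
    assume R: ?R
    show ?L
    proof (cases "j = Suc i \<or> j = 0 \<and> Suc i = n")
      case True
      then show ?thesis using R by (intro exI[of _ i]) auto
    next
      case False
      then show ?thesis using R by (intro exI[of _ j]) auto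
    qed
  qed
  finally show ?thesis .
qed

lemma metric_graph_cycle:
  assumes "3 \<le> n"
  shows "metric_graph (cycle_graph n) (cyc_dist n)"
proof
  fix u v w
  show "adjacent (cycle_graph n) u v \<Longrightarrow> u \<in> verts (cycle_graph n) \<and> v \<in> verts (cycle_graph n)"
    by (auto simp: adjacent_cycle_graph assms)
  show "u \<in> verts (cycle_graph n) \<Longrightarrow> v \<in> verts (cycle_graph n) \<Longrightarrow> cyc_dist n u v = 0 \<longleftrightarrow> u = v"
    by (auto simp: cyc_dist_def Let_def)
  show "cyc_dist n u v = cyc_dist n v u" by (auto simp: cyc_dist_def)
  show "cyc_dist n u v \<le> Suc (cyc_dist n w v)"
    if "adjacent (cycle_graph n) u w" "v \<in> verts (cycle_graph n)"
    using that by (auto simp: cyc_dist_def adjacent_cycle_graph assms Let_def min_def split: if_splits)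
  assume uv: "u \<in> verts (cycle_graph n)" "v \<in> verts (cycle_graph n)" "u \<noteq> v"
  \<comment> \<open>Successor and predecessor on the cycle. The four cases below decide whether the
    arc within the interval or the one through \<open>0\<close> and \<open>n - 1\<close> is
    shortest, and hence which of the two is the right first step.\<close>
  define w1 where "w1 = (if Suc u = n then 0 else Suc u)"
  define w2 where "w2 = (if u = 0 then n - 1 else u - 1)"
  have "adjacent (cycle_graph n) u w1" "adjacent (cycle_graph n) u w2"
    using uv assms by (auto simp: adjacent_cycle_graph w1_def w2_def)
  moreover have "cyc_dist n u v = Suc (cyc_dist n w1 v) \<or> cyc_dist n u v = Suc (cyc_dist n w2 v)"
  proof -
    consider "u < v" "2 * (v - u) \<le> n" | "v < u" "2 * (u - v) \<le> n"
      | "u < v" "n < 2 * (v - u)" | "v < u" "n < 2 * (u - v)"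
      using uv by linarith
    then show ?thesis
    proof cases
      case 1
      then have "w1 = Suc u" using uv by (auto simp: w1_def)
      then show ?thesis using 1 by (intro disjI1) (simp add: cyc_dist_def)
    next
      case 2
      then have "w2 = u - 1" by (auto simp: w2_def)
      then show ?thesis using 2 by (intro disjI2) (auto simp: cyc_dist_def)
    next
      case 3
      then show ?thesis using uv 
        by (intro disjI2) (cases "u = 0"; auto simp: cyc_dist_def w2_def)
    next
      case 4
      then show ?thesis using uv 
        by (intro disjI1) (cases "Suc u = n"; auto simp: cyc_dist_def w1_def)
    qed
  qed
  ultimately show "\<exists>w. adjacent (cycle_graph n) u w \<and> cyc_dist n u v = Suc (cyc_dist n w v)"
    by blast
qed

locale cycle =
  fixes n :: nat
  assumes n4: "4 \<le> n"
begin

abbreviation adj :: "nat \<Rightarrow> nat \<Rightarrow> bool" where "adj \<equiv> adjacent (cycle_graph n)"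

sublocale metric_graph "cycle_graph n" "cyc_dist n"
  using n4 by (intro metric_graph_cycle) simp

lemma adj_iff: "adj i j \<longleftrightarrow> i < n \<and> j < n \<and>
    (j = Suc i \<or> i = Suc j \<or> i = 0 \<and> Suc j = n \<or> j = 0 \<and> Suc i = n)"
  using n4 by (simp add: adjacent_cycle_graph)

lemmas cyc = adj_iff cyc_dist_def Let_def min_def

section \<open>Shortest arcs of a cycle\<close>

lemma geodesic_up:
  assumes "s \<le> t" "t < n" "2 * (t - s) \<le> n"
  shows "geodesic s t {s..t}"
proof -
  have "successively adj [s..<Suc t]"
    using assms by (auto simp: successively_conv_nth adj_iff simp del: upt_Suc)
  then have "walk (cycle_graph n) s t [s..<Suc t]" using assms
    by (auto simp: walk_def hd_upt last_upt simp del: upt_Suc)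
  then show ?thesis unfolding geodesic_def using assms
    by (intro exI[of _ "[s..<Suc t]"]) (auto simp: cyc_dist_def Let_def min_def simp del: upt_Suc)
qed

lemma geodesic_down:
  assumes "t \<le> s" "s < n" "2 * (s - t) \<le> n"
  shows "geodesic s t {t..s}"
  using geodesic_up[OF assms] by (rule geodesic_commute)

text \<open>The arc is glued from a descent to \<open>0\<close>, the closing edge, and a descent
  from \<open>n - 1\<close>. The bounds here and in \<open>geodesic_up\<close> overlap at equality,
  so antipodal vertices get both arcs.\<close>

lemma geodesic_wrap:
  assumes "s < t" "t < n" "n \<le> 2 * (t - s)"
  shows "geodesic s t ({..s} \<union> {t..<n})"
proof -
  have "geodesic s 0 {0..s}" "geodesic (n - 1) t {t..n - 1}"
    using assms by (auto intro!: geodesic_down)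
  moreover have "geodesic 0 (n - 1) {0, n - 1}"
    using assms by (intro geodesic_edge) (auto simp: adj_iff)
  moreover have "cyc_dist n s 0 = s" "cyc_dist n 0 (n - 1) = 1" "cyc_dist n s (n - 1) = s + 1"
    "cyc_dist n (n - 1) t = n - 1 - t" "cyc_dist n s t = n - (t - s)"
    using assms n4 by (auto simp: cyc_dist_def)
  ultimately have "geodesic s t (({0..s} \<union> {0, n - 1}) \<union> {t..n - 1})"
    using assms by (intro geodesic_trans[of s "n - 1"] geodesic_trans[of s 0]) simp_all
  moreover have "({0..s} \<union> {0, n - 1}) \<union> {t..n - 1} = {..s} \<union> {t..<n}" using assms by auto
  ultimately show ?thesis by simp
qed

section \<open>Antipodes and neighbours lying closer\<close>

lemma dist_le: "2 * cyc_dist n i j \<le> n"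
  by (auto simp: cyc)

lemma dist_1: "i < n \<Longrightarrow> j < n \<Longrightarrow> adj i j \<longleftrightarrow> cyc_dist n i j = 1"
  using n4 by (auto simp: cyc)

lemma adj_irrefl: "\<not> adj i i"
  using n4 by (auto simp: adj_iff)

lemma no_triangle: "adj i j \<Longrightarrow> adj j k \<Longrightarrow> \<not> adj i k"
  using n4 by (auto simp: adj_iff)

lemma antipode_iff:
  assumes "i < n" "j < n"
  shows "2 * cyc_dist n i j = n \<longleftrightarrow> 2 * j = 2 * i + n \<or> 2 * i = 2 * j + n"
proof (cases "i \<le> j")
  case True
  then show ?thesis using assms by (simp add: cyc_dist_def Let_def min_def) linarith
next
  case False
  then show ?thesis using assms by (simp add: cyc_dist_def Let_def min_def) linarith
qed

lemma antipode_unique: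
  assumes "i < n" "j < n" "k < n" "2 * cyc_dist n i j = n" "2 * cyc_dist n i k = n"
  shows "j = k"
  using assms by (simp add: antipode_iff) linarith

lemma adj_cases:
  assumes "adj i a"
  obtains "a = (if Suc i = n then 0 else Suc i)" | "a = (if i = 0 then n - 1 else i - 1)"
  using assms by (auto simp: adj_iff split: if_splits)

text \<open>The conclusion says that ascending from \<open>i\<close> reaches \<open>j\<close> within
  n/2 steps. Otherwise the descending arc is the strictly shorter one, its length is the distance,
  and a step up moves away from \<open>j\<close>. \<open>pred_closer\<close> is the mirror
  image.\<close>

lemma succ_closer:
  assumes "i < n" "j < n" "cyc_dist n (if Suc i = n then 0 else Suc i) j < cyc_dist n i j"
  shows "i \<le> j \<and> 2 * (j - i) \<le> n \<or> j < i \<and> n \<le> 2 * (i - j)"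
proof (rule ccontr)
  assume neg: "\<not> ?thesis"
  show False
  proof (cases "i \<le> j")
    case True
    then have "cyc_dist n i j = n - (j - i)" using neg by (simp add: cyc_dist_def)
    moreover have "j \<noteq> i" "Suc i \<noteq> n" using neg True assms by auto
    moreover from this have "cyc_dist n (Suc i) j = min (j - Suc i) (n - (j - Suc i))"
      using True by (simp add: cyc_dist_def)
    ultimately show False using assms neg True by auto
  next
    case False
    then have "cyc_dist n i j = i - j" using neg by (simp add: cyc_dist_def)
    moreover have "cyc_dist n (Suc i) j = min (Suc i - j) (n - (Suc i - j))"
      using False by (simp add: cyc_dist_def)
    moreover have "cyc_dist n 0 j = min j (n - j)" by (simp add: cyc_dist_def)
    ultimately show False using assms neg False by (auto split: if_splits)
  qed
qed

lemma pred_closer: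
  assumes "i < n" "j < n" "cyc_dist n (if i = 0 then n - 1 else i - 1) j < cyc_dist n i j"
  shows "j \<le> i \<and> 2 * (i - j) \<le> n \<or> i < j \<and> n \<le> 2 * (j - i)"
proof (rule ccontr)
  assume neg: "\<not> ?thesis"
  show False
  proof (cases "i < j")
    case True
    then have "cyc_dist n i j = j - i" using neg by (simp add: cyc_dist_def)
    moreover have "i \<noteq> 0 \<Longrightarrow> cyc_dist n (i - 1) j = min (j - (i - 1)) (n - (j - (i - 1)))"
      using True by (simp add: cyc_dist_def)
    moreover have "cyc_dist n (n - 1) j = min (n - 1 - j) (n - (n - 1 - j))"
      using assms by (cases "j = n - 1") (auto simp: cyc_dist_def)
    ultimately show False using assms neg True by (auto split: if_splits)
  next
    case False
    then have "cyc_dist n i j = n - (i - j)" using neg by (auto simp: cyc_dist_def)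
    moreover have "i \<noteq> j" "i \<noteq> 0" using neg False by auto
    moreover from this have "cyc_dist n (i - 1) j = min (i - 1 - j) (n - (i - 1 - j))"
      using False by (simp add: cyc_dist_def)
    ultimately show False using assms neg False by auto
  qed
qed

text \<open>If both directions help, neither arc exceeds n/2 and both have length exactly n/2. The
  case \<open>i = j\<close>, where the two conclusions overlap, has to be excluded first.\<close>

lemma not_both_closer:
  assumes "i < n" "j < n" "2 * cyc_dist n i j \<noteq> n"
    "cyc_dist n (if Suc i = n then 0 else Suc i) j < cyc_dist n i j"
    "cyc_dist n (if i = 0 then n - 1 else i - 1) j < cyc_dist n i j"
  shows False
proof -
  have "i \<noteq> j" using assms(4) by (auto simp: cyc_dist_def)
  then have "2 * j = 2 * i + n \<or> 2 * i = 2 * j + n"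
    using succ_closer[OF assms(1,2,4)] pred_closer[OF assms(1,2,5)] by linarith
  then show False using assms(3) antipode_iff[OF assms(1,2)] by simp
qed

lemma closer_unique:
  assumes "j < n" "adj i a" "adj i b" "cyc_dist n a j < cyc_dist n i j"
    "cyc_dist n b j < cyc_dist n i j" "2 * cyc_dist n i j \<noteq> n"
  shows "a = b"
proof -
  have "i < n" using assms(2) by (simp add: adj_iff)
  note no = not_both_closer[OF this assms(1,6)]
  define p where "p = (if Suc i = n then 0 else Suc i)"
  define q where "q = (if i = 0 then n - 1 else i - 1)"
  have "a = p \<or> a = q" "b = p \<or> b = q"
    using adj_cases assms(2,3) unfolding p_def q_def by blast+
  then show ?thesis using no[folded p_def q_def] assms(4,5) by blast
qed

lemma card_adj_le: "card {a. adj i a \<and> P a} \<le> 2" "finite {a. adj i a \<and> P a}"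
proof -
  have "{a. adj i a \<and> P a} \<subseteq> {if Suc i = n then 0 else Suc i, if i = 0 then n - 1 else i - 1}"
    by (auto simp: adj_iff)
  note * = this
  show "finite {a. adj i a \<and> P a}" by (rule finite_subset[OF *]) simp
  show "card {a. adj i a \<and> P a} \<le> 2"
    by (rule order.trans[OF card_mono[OF _ *]]) (auto simp: card_insert_if)
qed

lemma card_closer_le:
  assumes "j < n" "2 * cyc_dist n i j \<noteq> n"
  shows "card {a. adj i a \<and> cyc_dist n a j < cyc_dist n i j} \<le> 1"
  using closer_unique[OF assms(1)] assms(2) card_adj_le(2)
  by (auto simp: card_le_Suc0_iff_eq)

lemma equidistant_Suc:
  assumes "Suc s < n" "t < n" "cyc_dist n s t = cyc_dist n (Suc s) t"
  shows "2 * t = 2 * s + n + 1 \<or> 2 * t + n = 2 * s + 1"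
  using assms by (auto simp: cyc_dist_def Let_def min_def split: if_splits)

lemma equidistant_wrap:
  assumes "t < n" "cyc_dist n 0 t = cyc_dist n (n - 1) t"
  shows "2 * t + 1 = n"
  using assms n4 by (auto simp: cyc_dist_def Let_def min_def split: if_splits)

text \<open>The only possible vertex is the one opposite the edge, (n + 1)/2 steps beyond its first
  end. It exists only for odd \<open>n\<close>.\<close>

lemma equidistant_unique:
  assumes "adj s s'" "t < n" "t' < n"
    "cyc_dist n s t = cyc_dist n s' t" "cyc_dist n s t' = cyc_dist n s' t'"
  shows "t = t'"
proof -
  consider "s' = Suc s" "s' < n" | "s = Suc s'" "s < n" | "s = 0" "s' = n - 1" | "s = n - 1" "s' = 0"
    using assms(1) by (auto simp: adj_iff)
  then show ?thesis
  proof cases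
    case 1
    then show ?thesis using equidistant_Suc[of s t] equidistant_Suc[of s t'] assms by auto
  next
    case 2
    then show ?thesis using equidistant_Suc[of s' t] equidistant_Suc[of s' t'] assms by auto
  next
    case 3
    then show ?thesis using equidistant_wrap[of t] equidistant_wrap[of t'] assms by auto
  next
    case 4
    then show ?thesis using equidistant_wrap[of t] equidistant_wrap[of t'] assms by auto
  qed
qed

end

section \<open>Upper bounds on the torus\<close>

lemma three_distinct:
  assumes "\<not> card S \<le> 2" "finite S"
  obtains x y z where "x \<in> S" "y \<in> S" "z \<in> S" "x \<noteq> y" "x \<noteq> z" "y \<noteq> z"
proof -
  obtain T where "T \<subseteq> S" "card T = 3" using assms obtain_subset_with_card_n[of 3 S] by auto
  then show thesis using that by (auto simp: card_3_iff)
qed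

locale torus = M: cycle m + N: cycle n for m n
begin

sublocale two_metric_graphs "cycle_graph m" "cyc_dist m" "cycle_graph n" "cyc_dist n" ..

lemma verts_GH: "verts GH = {0..<m} \<times> {0..<n}"
  by (simp add: verts_cartesian_product)

lemma adjacent_torus:
  "adjacent GH (i, s) (j, t) \<longleftrightarrow> i = j \<and> i < m \<and> N.adj s t \<or> M.adj i j \<and> s = t \<and> s < n"
  by (simp add: adjacent_GH)

lemma ftmv_set_finite: "ftmv_set k GH X \<Longrightarrow> finite X"
  by (auto simp: ftmv_set_iff_linked verts_GH dest: finite_subset)

lemma ftmv_set_bounds: "ftmv_set k GH X \<Longrightarrow> (i, s) \<in> X \<Longrightarrow> i < m \<and> s < n"
  by (auto simp: ftmv_set_iff_linked verts_GH)

text \<open>A step in the torus changes one coordinate, so it brings the vertex closer exactly if it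
  does so in that cycle. The closer neighbours thus split into a row part and a column part that can
  be bounded separately.\<close>

lemma linked_count:
  assumes "linked k GH X (i, s) (j, t)" "i < m" "s < n" "j < m" "t < n"
    "(i, s) \<noteq> (j, t)" "\<not> adjacent GH (i, s) (j, t)"
  shows "Suc k \<le> card {a. M.adj i a \<and> (a, s) \<notin> X \<and> cyc_dist m a j < cyc_dist m i j} +
    card {b. N.adj s b \<and> (i, b) \<notin> X \<and> cyc_dist n b t < cyc_dist n s t}" (is "_ \<le> card ?A + card ?B")
proof -
  obtain W where W: "card W = Suc k"
    "\<And>w. w \<in> W \<Longrightarrow> adjacent GH (i, s) w \<and> w \<notin> X \<and> pdist w (j, t) < pdist (i, s) (j, t)"
    using P.linked_closer_neighbours[OF assms(1)] assms by (auto simp: verts_GH)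
  have "W \<subseteq> (\<lambda>a. (a, s)) ` ?A \<union> (\<lambda>b. (i, b)) ` ?B"
  proof
    fix w assume "w \<in> W"
    moreover obtain a b where "w = (a, b)" by (cases w)
    ultimately show "w \<in> (\<lambda>a. (a, s)) ` ?A \<union> (\<lambda>b. (i, b)) ` ?B"
      using W(2)[of w] by (auto simp: adjacent_torus)
  qed
  moreover have fin: "finite ?A" "finite ?B" using M.card_adj_le(2) N.card_adj_le(2) by auto
  ultimately have "card W \<le> card ((\<lambda>a. (a, s)) ` ?A \<union> (\<lambda>b. (i, b)) ` ?B)"
    by (intro card_mono) auto
  also have "\<dots> \<le> card ((\<lambda>a. (a, s)) ` ?A) + card ((\<lambda>b. (i, b)) ` ?B)" by (rule card_Un_le)
  also have "\<dots> \<le> card ?A + card ?B" using fin by (intro add_mono card_image_le)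
  finally show ?thesis using W(1) by simp
qed

lemma ftmv_count:
  assumes "ftmv_set k GH X" "(i, s) \<in> X" "(j, t) \<in> X" "(i, s) \<noteq> (j, t)" "\<not> adjacent GH (i, s) (j, t)"
  shows "Suc k \<le> card {a. M.adj i a \<and> (a, s) \<notin> X \<and> cyc_dist m a j < cyc_dist m i j} +
    card {b. N.adj s b \<and> (i, b) \<notin> X \<and> cyc_dist n b t < cyc_dist n s t}"
  using assms ftmv_set_bounds[OF assms(1)] by (intro linked_count) (auto simp: ftmv_set_iff_linked)

lemma card_closer_row:
  "card {a. M.adj i a \<and> (a, s) \<notin> X \<and> cyc_dist m a j < cyc_dist m i j} \<le> 2"
  "j < m \<Longrightarrow> 2 * cyc_dist m i j \<noteq> m \<Longrightarrow>
    card {a. M.adj i a \<and> (a, s) \<notin> X \<and> cyc_dist m a j < cyc_dist m i j} \<le> 1"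
  "i = j \<Longrightarrow> card {a. M.adj i a \<and> (a, s) \<notin> X \<and> cyc_dist m a j < cyc_dist m i j} = 0"
proof -
  show "card {a. M.adj i a \<and> (a, s) \<notin> X \<and> cyc_dist m a j < cyc_dist m i j} \<le> 2"
    by (rule M.card_adj_le)
  show "card {a. M.adj i a \<and> (a, s) \<notin> X \<and> cyc_dist m a j < cyc_dist m i j} \<le> 1"
    if "j < m" "2 * cyc_dist m i j \<noteq> m"
    by (rule order.trans[OF card_mono M.card_closer_le[OF that]]) (use M.card_adj_le(2) in auto)
  show "card {a. M.adj i a \<and> (a, s) \<notin> X \<and> cyc_dist m a j < cyc_dist m i j} = 0" if "i = j"
    using that by (auto simp: cyc_dist_def)
qed

lemma card_closer_column:
  "card {b. N.adj s b \<and> (i, b) \<notin> X \<and> cyc_dist n b t < cyc_dist n s t} \<le> 2"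
  "t < n \<Longrightarrow> 2 * cyc_dist n s t \<noteq> n \<Longrightarrow>
    card {b. N.adj s b \<and> (i, b) \<notin> X \<and> cyc_dist n b t < cyc_dist n s t} \<le> 1"
  "s = t \<Longrightarrow> card {b. N.adj s b \<and> (i, b) \<notin> X \<and> cyc_dist n b t < cyc_dist n s t} = 0"
proof -
  show "card {b. N.adj s b \<and> (i, b) \<notin> X \<and> cyc_dist n b t < cyc_dist n s t} \<le> 2"
    by (rule N.card_adj_le)
  show "card {b. N.adj s b \<and> (i, b) \<notin> X \<and> cyc_dist n b t < cyc_dist n s t} \<le> 1"
    if "t < n" "2 * cyc_dist n s t \<noteq> n"
    by (rule order.trans[OF card_mono N.card_closer_le[OF that]]) (use N.card_adj_le(2) in auto)
  show "card {b. N.adj s b \<and> (i, b) \<notin> X \<and> cyc_dist n b t < cyc_dist n s t} = 0" if "s = t"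
    using that by (auto simp: cyc_dist_def)
qed

text \<open>By \<open>closer_unique\<close>, \<open>s'\<close> is the only column step towards
  \<open>t\<close>, and it is occupied.\<close>

lemma card_closer_column_blocked:
  assumes "t < n" "2 * cyc_dist n s t \<noteq> n" "N.adj s s'" "(i, s') \<in> X" "cyc_dist n s' t < cyc_dist n s t"
  shows "card {b. N.adj s b \<and> (i, b) \<notin> X \<and> cyc_dist n b t < cyc_dist n s t} = 0"
proof -
  have "{b. N.adj s b \<and> (i, b) \<notin> X \<and> cyc_dist n b t < cyc_dist n s t} = {}"
    using N.closer_unique[OF assms(1) _ assms(3) _ assms(5,2)] assms(4) by blast
  then show ?thesis by (simp only: card.empty)
qed

text \<open>Within one column the row part of the count vanishes, so the column part must be 2. This
  needs antipodal ends and both neighbours of \<open>s\<close> unoccupied.\<close>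

lemma column_pair:
  assumes X: "ftmv_set 1 GH X" "(i, s) \<in> X" "(i, t) \<in> X" "s \<noteq> t" "\<not> N.adj s t"
  shows "2 * cyc_dist n s t = n" "N.adj s b \<Longrightarrow> (i, b) \<notin> X"
proof -
  have st: "s < n" "t < n" using X ftmv_set_bounds by blast+
  have "\<not> adjacent GH (i, s) (i, t)" using X by (auto simp: adjacent_torus M.adj_iff)
  then have 2: "2 \<le> card {b. N.adj s b \<and> (i, b) \<notin> X \<and> cyc_dist n b t < cyc_dist n s t}"
    using ftmv_count[OF X(1,2,3)] X(4) card_closer_row(3)[of i i s X] by simp
  then show "2 * cyc_dist n s t = n" using card_closer_column(2)[OF st(2), of s i X] by linarith
  show "(i, b) \<notin> X" if b: "N.adj s b"
  proof
    assume "(i, b) \<in> X"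
    then have "{b. N.adj s b \<and> (i, b) \<notin> X \<and> cyc_dist n b t < cyc_dist n s t} \<subseteq> {b. N.adj s b \<and> True} - {b}"
      by auto
    then have "card {b. N.adj s b \<and> (i, b) \<notin> X \<and> cyc_dist n b t < cyc_dist n s t}
        \<le> card ({b. N.adj s b \<and> True} - {b})"
      using N.card_adj_le(2)[of s "\<lambda>_. True"] by (intro card_mono) auto
    then have "2 \<le> card ({b. N.adj s b \<and> True} - {b})" using 2 by linarith
    then show False
      using b N.card_adj_le[of s "\<lambda>_. True"] card_Diff_singleton[of b "{b. N.adj s b \<and> True}"] by simp
  qed
qed

lemma column_subset: "ftmv_set k GH X \<Longrightarrow> {y. (i, y) \<in> X} \<subseteq> {0..<n}"
  using ftmv_set_bounds by auto

lemma column_finite: "ftmv_set k GH X \<Longrightarrow> finite {y. (i, y) \<in> X}"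
  using column_subset by (rule finite_subset) auto

text \<open>Suppose two of three vertices in a column are not adjacent. They are antipodal, and the
  third, which cannot be a neighbour of the first, would be a second antipode of it. So all three
  are pairwise adjacent, but a cycle of length at least 4 has no triangle.\<close>

lemma column_le_2:
  assumes X: "ftmv_set 1 GH X"
  shows "card {y. (i, y) \<in> X} \<le> 2"
proof (rule ccontr)
  have no: "N.adj s t" if "(i, s) \<in> X" "(i, t) \<in> X" "(i, r) \<in> X" "s \<noteq> t" "s \<noteq> r" "t \<noteq> r" for s t r
  proof (rule ccontr)
    assume "\<not> N.adj s t"
    note st = column_pair[OF X that(1,2,4) this]
    then have "\<not> N.adj s r" using that(3) by blast
    then have "2 * cyc_dist n s r = n" using column_pair(1)[OF X that(1,3,5)] by blast
    then show False
      using N.antipode_unique[of s t r] st(1) that ftmv_set_bounds[OF X] by blast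
  qed
  assume "\<not> card {y. (i, y) \<in> X} \<le> 2"
  then obtain s t r where "(i, s) \<in> X" "(i, t) \<in> X" "(i, r) \<in> X" "s \<noteq> t" "s \<noteq> r" "t \<noteq> r"
    by (rule three_distinct) (use column_finite[OF X] in auto)
  then show False using no[of s t r] no[of t r s] no[of s r t] N.no_triangle[of s t r] by blast
qed

lemma card_le_by_columns:
  assumes X: "ftmv_set k GH X" and c: "\<And>i. i < m \<Longrightarrow> card {y. (i, y) \<in> X} \<le> c"
  shows "card X \<le> m * c"
proof -
  have "X = Sigma {0..<m} (\<lambda>i. {y. (i, y) \<in> X})" using ftmv_set_bounds[OF X] by auto
  then have "card X = card (Sigma {0..<m} (\<lambda>i. {y. (i, y) \<in> X}))" by (rule arg_cong)
  also have "\<dots> = (\<Sum>i\<in>{0..<m}. card {y. (i, y) \<in> X})"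
    using column_finite[OF X] by (intro card_SigmaI) auto
  also have "\<dots> \<le> (\<Sum>i\<in>{0..<m}. c)" using c by (intro sum_mono) auto
  finally show ?thesis by simp
qed

lemma ftmv_1_le: "ftmv_set 1 GH X \<Longrightarrow> card X \<le> 2 * m"
  using card_le_by_columns[of 1 X 2] column_le_2 by simp

end

text \<open>Rows are the columns of the torus with factors exchanged, so each column result is
  available for rows through \<open>ftmv_set_swap\<close>.\<close>

sublocale torus \<subseteq> swap: torus n m ..

context torus
begin

lemma ftmv_set_swap: "ftmv_set k GH X \<Longrightarrow> ftmv_set k swap.GH (prod.swap ` X)"
  by (rule ftmv_set_iso[OF graph_iso_swap])

lemma row_le_2:
  assumes "ftmv_set 1 GH X"
  shows "card {x. (x, s) \<in> X} \<le> 2" "finite {x. (x, s) \<in> X}"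
proof -
  have "{x. (x, s) \<in> X} = {x. (s, x) \<in> prod.swap ` X}" by simp
  then show "card {x. (x, s) \<in> X} \<le> 2" "finite {x. (x, s) \<in> X}"
    using swap.column_le_2[OF ftmv_set_swap[OF assms], of s]
      swap.column_finite[OF ftmv_set_swap[OF assms], of s] by auto
qed

text \<open>Outside the antipodal column the row part is at most 1, and the column part is at most 1
  because \<open>n\<close> is odd. If \<open>s'\<close> were closer to \<open>t\<close>, it would
  block the only column step. Exchanging \<open>s\<close> and \<open>s'\<close> turns the inequality
  into equality.\<close>

lemma column_edge_equidistant:
  assumes X: "ftmv_set 1 GH X" "odd n" "(i, s) \<in> X" "(i, s') \<in> X" "N.adj s s'"
    "(j, t) \<in> X" "j \<noteq> i" "2 * cyc_dist m i j \<noteq> m"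
  shows "cyc_dist n s t \<le> cyc_dist n s' t"
proof (rule ccontr)
  assume less: "\<not> cyc_dist n s t \<le> cyc_dist n s' t"
  then have "s \<noteq> t" by (auto simp: cyc_dist_def)
  have b: "j < m" "t < n" using ftmv_set_bounds X by blast+
  have odd: "2 * cyc_dist n s t \<noteq> n" using X(2) by (metis dvd_triv_left)
  have "\<not> adjacent GH (i, s) (j, t)" using X(7) \<open>s \<noteq> t\<close> by (auto simp: adjacent_torus)
  then have "2 \<le> card {a. M.adj i a \<and> (a, s) \<notin> X \<and> cyc_dist m a j < cyc_dist m i j} +
      card {b. N.adj s b \<and> (i, b) \<notin> X \<and> cyc_dist n b t < cyc_dist n s t}"
    using ftmv_count[OF X(1,3,6)] X(7) by simp
  then show False
    using card_closer_row(2)[OF b(1) X(8), of s X]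
      card_closer_column_blocked[OF b(2) odd X(5,4)] less by simp
qed

text \<open>The bound \<open>m\<close> is the case of at most one vertex per column. Otherwise some
  column \<open>i\<close> contains an edge; this column and the row opposite the edge contain at
  most two vertices each, which gives 4, and the antipodal column, present only for even
  \<open>m\<close>, adds at most 2.\<close>

lemma ftmv_1_odd:
  assumes X: "ftmv_set 1 GH X" and n: "odd n"
  shows "card X \<le> m \<or> card X \<le> 4 \<or> even m \<and> card X \<le> 6"
proof (cases "\<forall>i<m. card {y. (i, y) \<in> X} \<le> 1")
  case True
  then show ?thesis using card_le_by_columns[OF X, of 1] by simp
next
  case False
  note fin = column_finite[OF X]
  obtain i where "\<not> card {y. (i, y) \<in> X} \<le> 1" using False by blast
  then obtain s s' where s: "(i, s) \<in> X" "(i, s') \<in> X" "s \<noteq> s'"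
    using card_le_Suc0_iff_eq[OF fin, of i] by auto
  have i: "i < m" using s X ftmv_set_bounds by blast
  have adj: "N.adj s s'" using column_pair(1)[OF X s] n by (metis dvd_triv_left)
  define J where "J = {j. j \<noteq> i \<and> j < m \<and> 2 * cyc_dist m i j = m}"
  have eq: "t = t'" if "(j, t) \<in> X" "(j', t') \<in> X" "j \<noteq> i" "j' \<noteq> i" "j \<notin> J" "j' \<notin> J" for j t j' t'
  proof -
    have jt: "j < m" "t < n" "j' < m" "t' < n" using that X ftmv_set_bounds by blast+
    have J: "2 * cyc_dist m i j \<noteq> m" "2 * cyc_dist m i j' \<noteq> m" using that jt by (auto simp: J_def)
    have adj': "N.adj s' s" using adj adjacent_commute by metis
    have "cyc_dist n s t = cyc_dist n s' t" "cyc_dist n s t' = cyc_dist n s' t'"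
      using column_edge_equidistant[OF X n s(1,2) adj that(1,3) J(1)]
        column_edge_equidistant[OF X n s(2,1) adj' that(1,3) J(1)]
        column_edge_equidistant[OF X n s(1,2) adj that(2,4) J(2)]
        column_edge_equidistant[OF X n s(2,1) adj' that(2,4) J(2)] by auto
    then show ?thesis using N.equidistant_unique[OF adj jt(2,4)] by blast
  qed
  \<comment> \<open>If no such vertex exists, \<open>t\<close> is arbitrary and its row is merely a
    harmless extra summand.\<close>
  then obtain t where t: "\<And>j t'. (j, t') \<in> X \<Longrightarrow> j \<noteq> i \<Longrightarrow> j \<notin> J \<Longrightarrow> t' = t" by metis
  have J1: "\<exists>j. J \<subseteq> {j}"
    using M.antipode_unique[OF i] unfolding J_def by blast
  then obtain j where j: "J \<subseteq> {j}" by blast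
  \<comment> \<open>When \<open>J\<close> is empty, \<open>j\<close> is arbitrary, and its column
    must not be counted.\<close>
  define Z where "Z = (if J = {} then {} else {j} \<times> {y. (j, y) \<in> X})"
  have "X \<subseteq> {i} \<times> {y. (i, y) \<in> X} \<union> Z \<union> {x. (x, t) \<in> X} \<times> {t}"
  proof
    fix w assume w: "w \<in> X"
    obtain a b where ab: "w = (a, b)" by (cases w)
    show "w \<in> {i} \<times> {y. (i, y) \<in> X} \<union> Z \<union> {x. (x, t) \<in> X} \<times> {t}"
      using w ab t[of a b] j by (auto simp: Z_def)
  qed
  moreover have "finite Z" unfolding Z_def using fin by auto
  ultimately have "card X \<le> card ({i} \<times> {y. (i, y) \<in> X} \<union> Z \<union> {x. (x, t) \<in> X} \<times> {t})"
    using fin row_le_2(2)[OF X] by (intro card_mono) auto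
  also have "\<dots> \<le> card ({i} \<times> {y. (i, y) \<in> X}) + card Z + card ({x. (x, t) \<in> X} \<times> {t})"
    by (intro order.trans[OF card_Un_le] add_mono order.refl)
  also have "\<dots> \<le> 2 + card Z + 2"
    using column_le_2[OF X, of i] row_le_2(1)[OF X, of t] by (simp add: card_cartesian_product)
  finally have le: "card X \<le> 4 + card Z" by simp
  show ?thesis
  proof (cases "even m")
    case True
    have "card Z \<le> 2" using column_le_2[OF X, of j] by (simp add: Z_def card_cartesian_product)
    then show ?thesis using le True by simp
  next
    case False
    then have "2 * cyc_dist m i j \<noteq> m" for j by (metis dvd_triv_left)
    then have "J = {}" by (simp add: J_def)
    then show ?thesis using le by (simp add: Z_def)
  qed
qed

section \<open>Upper bounds for k at least 2\<close>

lemma ftmv_ge_2_pair: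
  assumes X: "ftmv_set k GH X" "2 \<le> k" "(i, s) \<in> X" "(j, t) \<in> X" "(i, s) \<noteq> (j, t)"
    "\<not> adjacent GH (i, s) (j, t)"
  shows "i \<noteq> j" "s \<noteq> t" "2 * cyc_dist m i j = m \<or> 2 * cyc_dist n s t = n"
    "3 \<le> k \<Longrightarrow> 2 * cyc_dist m i j = m \<and> 2 * cyc_dist n s t = n"
proof -
  note c = ftmv_count[OF X(1,3,4,5,6)]
  note r = card_closer_row[where i=i and j=j and s=s and X=X]
  note l = card_closer_column[where s=s and t=t and i=i and X=X]
  have b: "j < m" "t < n" using ftmv_set_bounds X by blast+
  \<comment> \<open>At least three closer neighbours are needed. A cycle contributes none if the
    coordinates agree and two only if they are antipodal, so both cycles contribute and one of them
    twice; four neighbours require both to contribute twice.\<close>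
  show "i \<noteq> j" using c r(3) l(1) X(2) by linarith
  show "s \<noteq> t" using c r(1) l(3) X(2) by linarith
  show "2 * cyc_dist m i j = m \<or> 2 * cyc_dist n s t = n"
    using c r(2)[OF b(1)] l(2)[OF b(2)] X(2) by linarith
  show "2 * cyc_dist m i j = m \<and> 2 * cyc_dist n s t = n" if "3 \<le> k"
    using c r(2)[OF b(1)] l(2)[OF b(2)] r(1) l(1) that by linarith
qed

lemma ftmv_ge_2_dist:
  assumes X: "ftmv_set k GH X" "2 \<le> k" "u \<in> X" "v \<in> X" "u \<noteq> v" "\<not> adjacent GH u v"
  shows "3 \<le> pdist u v"
proof -
  obtain i s j t where uv: "u = (i, s)" "v = (j, t)" by (cases u, cases v)
  have b: "i < m" "s < n" "j < m" "t < n" using ftmv_set_bounds X uv by blast+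
  have p: "i \<noteq> j" "s \<noteq> t" "2 * cyc_dist m i j = m \<or> 2 * cyc_dist n s t = n"
    using ftmv_ge_2_pair[OF X(1,2)] X uv by blast+
  have "cyc_dist m i j \<noteq> 0" "cyc_dist n s t \<noteq> 0"
    using p b M.dist_eq_0 N.dist_eq_0 by auto
  then show ?thesis using p(3) M.n4 N.n4 uv by auto
qed

text \<open>Two vertices of \<open>X\<close> with a common neighbour have distance at most 2, hence
  would be adjacent and form a triangle with it. For \<open>w\<close> in \<open>X\<close> this says
  that the edges inside \<open>X\<close> form a matching.\<close>

lemma ftmv_ge_2_matching:
  assumes X: "ftmv_set k GH X" "2 \<le> k" "u \<in> X" "v \<in> X" "adjacent GH u w" "adjacent GH w v"
  shows "u = v"
proof (rule ccontr)
  assume "u \<noteq> v"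
  have V: "v \<in> verts GH" using X(1,4) by (auto simp: ftmv_set_iff_linked)
  have "pdist v v = 0" using P.dist_eq_0 V by blast
  then have "pdist u v \<le> 2" using P.dist_step[OF X(5) V] P.dist_step[OF X(6) V] by simp
  then have "adjacent GH u v" using ftmv_ge_2_dist[OF X(1-4)] \<open>u \<noteq> v\<close> by fastforce
  moreover obtain i s j t a b where "u = (i, s)" "v = (j, t)" "w = (a, b)" by (cases u, cases v, cases w)
  ultimately have "adjacent GH (i, s) (j, t)" "adjacent GH (i, s) (a, b)" "adjacent GH (a, b) (j, t)"
    using X(5,6) by simp_all
  then show False using
      M.adj_irrefl M.no_triangle[of i a j] N.adj_irrefl N.no_triangle[of s b t]
    unfolding adjacent_torus by blast
qed

text \<open>A vertex of \<open>X\<close> has at most one non-neighbour in \<open>X\<close>, its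
  antipode in both coordinates, and at most one neighbour in \<open>X\<close>. With three vertices,
  a non-adjacent pair would make the third adjacent to both.\<close>

lemma ftmv_ge_3_le:
  assumes X: "ftmv_set k GH X" "3 \<le> k"
  shows "card X \<le> 2"
proof (rule ccontr)
  have k: "2 \<le> k" using X by simp
  have uniq: "y = z"
    if xyz: "x \<in> X" "y \<in> X" "z \<in> X" "x \<noteq> y" "x \<noteq> z" "\<not> adjacent GH x y" "\<not> adjacent GH x z" for x y z
  proof -
    obtain i s j t a b where c: "x = (i, s)" "y = (j, t)" "z = (a, b)" by (cases x, cases y, cases z)
    have bd: "i < m" "s < n" "j < m" "t < n" "a < m" "b < n"
      using ftmv_set_bounds[OF X(1)] xyz c by blast+
    have "2 * cyc_dist m i j = m \<and> 2 * cyc_dist n s t = n"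
      using ftmv_ge_2_pair(4)[OF X(1) k _ _ _ _ X(2), of i s j t] xyz c by blast
    moreover have "2 * cyc_dist m i a = m \<and> 2 * cyc_dist n s b = n"
      using ftmv_ge_2_pair(4)[OF X(1) k _ _ _ _ X(2), of i s a b] xyz c by blast
    ultimately show ?thesis
      using M.antipode_unique[of i j a] N.antipode_unique[of s t b] bd c by blast
  qed
  have no: "adjacent GH x y"
    if xyz: "x \<in> X" "y \<in> X" "z \<in> X" "x \<noteq> y" "x \<noteq> z" "y \<noteq> z" for x y z
  proof (rule ccontr)
    assume nadj: "\<not> adjacent GH x y"
    have "\<not> (adjacent GH x z \<and> adjacent GH z y)"
      using ftmv_ge_2_matching[OF X(1) k xyz(1,2)] xyz(4) by blast
    then show False
      using uniq[of x y z] uniq[of y x z] nadj xyz adjacent_commute[of GH] by blast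
  qed
  assume "\<not> card X \<le> 2"
  then obtain x y z where xyz: "x \<in> X" "y \<in> X" "z \<in> X" "x \<noteq> y" "x \<noteq> z" "y \<noteq> z"
    by (rule three_distinct) (use ftmv_set_finite X in auto)
  then have "adjacent GH x z" "adjacent GH z y" using no[of x z y] no[of z y x] by auto
  then show False using ftmv_ge_2_matching[OF X(1) k xyz(1,2)] xyz by blast
qed

lemma ftmv_2_column:
  assumes X: "ftmv_set k GH X" "2 \<le> k"
  shows "card {y. (i, y) \<in> X} \<le> 2"
proof (rule ccontr)
  assume "\<not> card {y. (i, y) \<in> X} \<le> 2"
  then obtain s t r where "(i, s) \<in> X" "(i, t) \<in> X" "(i, r) \<in> X" "s \<noteq> t" "s \<noteq> r" "t \<noteq> r"
    by (rule three_distinct) (use column_finite[OF X(1)] in auto)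
  moreover have "N.adj s t" if "(i, s) \<in> X" "(i, t) \<in> X" "s \<noteq> t" for s t
    using ftmv_ge_2_pair(1)[OF X that(1,2)] that(3) by (auto simp: adjacent_torus M.adj_irrefl)
  ultimately show False using N.no_triangle[of s t r] by blast
qed

text \<open>Seen from a fixed \<open>x\<close>, the rest of \<open>X\<close> consists of neighbours
  and of vertices antipodal to \<open>x\<close> in one coordinate. \<open>F1\<close> lies in a
  single column. If \<open>F1\<close> and \<open>F2\<close> were incomparable, two witnesses would
  themselves be antipodal in a coordinate, against uniqueness of the antipode of \<open>x\<close>.
  So the total is at most 1 + 1 + 2.\<close>

lemma ftmv_2_le_aux:
  assumes X: "ftmv_set 2 GH X" and x: "x \<in> X"
  defines "N1 \<equiv> {y \<in> X. y \<noteq> x \<and> adjacent GH x y}"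
    and "F1 \<equiv> {y \<in> X. 2 * cyc_dist m (fst x) (fst y) = m \<and> snd x \<noteq> snd y}"
    and "F2 \<equiv> {y \<in> X. 2 * cyc_dist n (snd x) (snd y) = n \<and> fst x \<noteq> fst y}"
  shows "card N1 \<le> 1" "card F1 \<le> 2" "F1 \<subseteq> F2 \<or> F2 \<subseteq> F1" "X \<subseteq> {x} \<union> N1 \<union> (F1 \<union> F2)"
    "\<lbrakk>odd n; N1 \<noteq> {}\<rbrakk> \<Longrightarrow> card F1 \<le> 1"
proof -
  have fin: "finite X" using X by (rule ftmv_set_finite)
  note match = ftmv_ge_2_matching[OF X order.refl]
  obtain i s where xi: "x = (i, s)" by (cases x)
  have is_bd: "i < m" "s < n" using ftmv_set_bounds[OF X] x xi by blast+
  show "card N1 \<le> 1"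
    unfolding One_nat_def N1_def
    using match[of _ _ x] fin adjacent_commute[of GH] by (subst card_le_Suc0_iff_eq) auto
  show "X \<subseteq> {x} \<union> N1 \<union> (F1 \<union> F2)"
  proof
    fix y assume y: "y \<in> X"
    obtain j t where yj: "y = (j, t)" by (cases y)
    show "y \<in> {x} \<union> N1 \<union> (F1 \<union> F2)"
    proof (cases "x = y \<or> adjacent GH x y")
      case True
      then show ?thesis using y by (auto simp: N1_def)
    next
      case False
      then have "i \<noteq> j" "s \<noteq> t" "2 * cyc_dist m i j = m \<or> 2 * cyc_dist n s t = n"
        using ftmv_ge_2_pair[OF X order.refl, of i s j t] x y xi yj by blast+
      then show ?thesis using y xi yj by (auto simp: F1_def F2_def)
    qed
  qed
  have F1: "(a, b) \<in> F1 \<longleftrightarrow> (a, b) \<in> X \<and> 2 * cyc_dist m i a = m \<and> s \<noteq> b" for a b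
    by (auto simp: F1_def xi)
  have F2: "(a, b) \<in> F2 \<longleftrightarrow> (a, b) \<in> X \<and> 2 * cyc_dist n s b = n \<and> i \<noteq> a" for a b
    by (auto simp: F2_def xi)
  have F1_sub: "\<exists>j. F1 \<subseteq> {j} \<times> {y. (j, y) \<in> X}"
  proof (cases "F1 = {}")
    case False
    then obtain j t where jt: "(j, t) \<in> F1" by auto
    have "a = j" if "(a, b) \<in> F1" for a b
      using M.antipode_unique[OF is_bd(1), of a j] that jt F1 ftmv_set_bounds[OF X] by blast
    then show ?thesis using F1 by (intro exI[of _ j]) auto
  qed auto
  then obtain j where j: "F1 \<subseteq> {j} \<times> {y. (j, y) \<in> X}" by blast
  have "card F1 \<le> card ({j} \<times> {y. (j, y) \<in> X})"
    using j column_finite[OF X] by (intro card_mono) auto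
  then show "card F1 \<le> 2" using ftmv_2_column[OF X order.refl, of j] by (simp add: card_cartesian_product)
  show "F1 \<subseteq> F2 \<or> F2 \<subseteq> F1"
  proof (rule ccontr)
    assume "\<not> (F1 \<subseteq> F2 \<or> F2 \<subseteq> F1)"
    then obtain a b c d where ab: "(a, b) \<in> F1" "(a, b) \<notin> F2" and cd: "(c, d) \<in> F2" "(c, d) \<notin> F1"
      by auto
    have bd: "a < m" "b < n" "c < m" "d < n" using ab cd F1 F2 ftmv_set_bounds[OF X] by blast+
    have *: "2 * cyc_dist m i a = m" "s \<noteq> b" "2 * cyc_dist n s d = n" "i \<noteq> c"
      using ab cd F1 F2 by blast+
    have "i \<noteq> a" "s \<noteq> d" using *(1,3) M.n4 N.n4 by (auto simp: cyc_dist_def)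
    then have ne: "a \<noteq> c" "b \<noteq> d" using ab cd F1 F2 by auto
    then have "\<not> adjacent GH (a, b) (c, d)" by (auto simp: adjacent_torus)
    then have "2 * cyc_dist m a c = m \<or> 2 * cyc_dist n b d = n"
      using ftmv_ge_2_pair(3)[OF X order.refl, of a b c d] ab cd F1 F2 ne by blast
    moreover have "2 * cyc_dist m a i = m" "2 * cyc_dist n d s = n" "cyc_dist n b d = cyc_dist n d b"
      using * M.dist_commute[of a i] N.dist_commute[of d s] N.dist_commute[of b d] by simp_all
    ultimately show False
      using M.antipode_unique[of a i c] N.antipode_unique[of d s b] bd is_bd * by metis
  qed
  show "card F1 \<le> 1" if n: "odd n" "N1 \<noteq> {}"
  proof -
    obtain i' s' where N1: "(i', s') \<in> N1" using n(2) by auto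
    then have x': "(i', s') \<in> X" "(i, s) \<noteq> (i', s')" "adjacent GH (i, s) (i', s')" by (auto simp: N1_def xi)
    \<comment> \<open>For odd \<open>n\<close> the neighbour of \<open>x\<close> must also be
      antipodal to \<open>j\<close> in the first coordinate, so it lies in the column of
      \<open>x\<close>. If one end of this edge were closer to \<open>t\<close>, it would block the
      column step of the other, leaving only two row steps where three are needed. So
      \<open>t\<close> is the vertex opposite the edge.\<close>
    have eq: "i' = i \<and> N.adj s s' \<and> cyc_dist n s t = cyc_dist n s' t" if t: "(j, t) \<in> F1" for t
    proof -
      have jt: "(j, t) \<in> X" "2 * cyc_dist m i j = m" "s \<noteq> t" using t F1 by auto
      have bd: "j < m" "t < n" "i' < m" "s' < n" using jt x' ftmv_set_bounds[OF X] by blast+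
      have ij: "i \<noteq> j" using jt(2) M.n4 by (auto simp: cyc_dist_def)
      have odd: "2 * cyc_dist n a b \<noteq> n" for a b using n(1) by (metis dvd_triv_left)
      have nadj: "\<not> adjacent GH (i, s) (j, t)" using ij jt(3) by (simp add: adjacent_torus)
      have "(i', s') \<noteq> (j, t)" using nadj x'(3) by auto
      moreover have nadj': "\<not> adjacent GH (i', s') (j, t)"
        using match[OF _ jt(1) x'(3), of] x xi ij by blast
      ultimately have "2 * cyc_dist m i' j = m" "s' \<noteq> t"
        using ftmv_ge_2_pair(2,3)[OF X order.refl x'(1) jt(1)] odd by blast+
      then have i': "i' = i" 
        using M.antipode_unique[of j i i'] bd is_bd jt(2) M.dist_commute[of j i] M.dist_commute[of j i'] by metis
      then have adj: "N.adj s s'" using x'(3) by (auto simp: adjacent_torus M.adj_irrefl)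
      then have adj': "N.adj s' s" using adjacent_commute by metis
      have "\<not> cyc_dist n s' t < cyc_dist n s t"
      proof
        assume "cyc_dist n s' t < cyc_dist n s t"
        then show False
          using ftmv_count[OF X _ jt(1) _ nadj] card_closer_row(1)[of i s X j]
            card_closer_column_blocked[OF bd(2) odd adj _, of i X] x'(1) i' x xi ij by simp
      qed
      moreover have "\<not> cyc_dist n s t < cyc_dist n s' t"
      proof
        assume "cyc_dist n s t < cyc_dist n s' t"
        then show False
          using ftmv_count[OF X _ jt(1) _ nadj'] card_closer_row(1)[of i s' X j]
            card_closer_column_blocked[OF bd(2) odd adj' _, of i X] x'(1) i' x xi ij by simp
      qed
      ultimately show ?thesis using i' adj by simp
    qed
    have "u = v" if uv: "u \<in> F1" "v \<in> F1" for u v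
    proof -
      obtain t t' where t: "u = (j, t)" "v = (j, t')" using uv j by blast
      then show ?thesis
        using eq[of t] eq[of t'] uv N.equidistant_unique[of s s' t t'] F1 ftmv_set_bounds[OF X] by blast
    qed
    moreover have "finite F1" using fin by (auto simp: F1_def)
    ultimately show ?thesis unfolding One_nat_def by (subst card_le_Suc0_iff_eq) auto
  qed
qed

end

context torus
begin

lemma ftmv_2_le:
  assumes X: "ftmv_set 2 GH X"
  shows "card X \<le> 4" "odd n \<Longrightarrow> card X \<le> 3" "odd m \<Longrightarrow> odd n \<Longrightarrow> card X \<le> 2"
proof -
  have fin: "finite X" using X by (rule ftmv_set_finite)
  have "card X \<le> 4 \<and> (odd n \<longrightarrow> card X \<le> 3) \<and> (odd m \<longrightarrow> odd n \<longrightarrow> card X \<le> 2)"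
  proof (cases "X = {}")
    case False
    then obtain x where x: "x \<in> X" by blast
    define N1 where "N1 = {y \<in> X. y \<noteq> x \<and> adjacent GH x y}"
    define F1 where "F1 = {y \<in> X. 2 * cyc_dist m (fst x) (fst y) = m \<and> snd x \<noteq> snd y}"
    define F2 where "F2 = {y \<in> X. 2 * cyc_dist n (snd x) (snd y) = n \<and> fst x \<noteq> fst y}"
    note aux = ftmv_2_le_aux[OF X x, folded N1_def F1_def F2_def]
    \<comment> \<open>This is the set \<open>F1\<close> of the exchanged torus, so the bound on
      \<open>F1\<close> applies to \<open>F2\<close>.\<close>
    let ?F2' = "{y \<in> prod.swap ` X. 2 * cyc_dist n (fst (prod.swap x)) (fst y) = n
        \<and> snd (prod.swap x) \<noteq> snd y}"
    have "?F2' = prod.swap ` F2" by (auto simp: F2_def)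
    then have "card F2 = card ?F2'" by (simp add: card_image)
    then have F2: "card F2 \<le> 2"
      using swap.ftmv_2_le_aux(2)[OF ftmv_set_swap[OF X], of "prod.swap x"] x by simp
    have "finite N1" "finite F1" "finite F2" using fin by (auto simp: N1_def F1_def F2_def)
    then have "card X \<le> card ({x} \<union> N1 \<union> (F1 \<union> F2))" using aux(4) by (intro card_mono) auto
    also have "\<dots> \<le> card {x} + card N1 + card (F1 \<union> F2)"
      by (intro order.trans[OF card_Un_le] add_mono order.refl)
    finally have le: "card X \<le> 1 + card N1 + card (F1 \<union> F2)" by simp
    have F: "F1 \<union> F2 = F1 \<or> F1 \<union> F2 = F2" using aux(3) by blast
    have "F2 = {}" if "odd n"
    proof -
      have "2 * cyc_dist n a b \<noteq> n" for a b using that by (metis dvd_triv_left)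
      then show ?thesis by (simp add: F2_def)
    qed
    moreover have "F1 = {}" if "odd m"
    proof -
      have "2 * cyc_dist m a b \<noteq> m" for a b using that by (metis dvd_triv_left)
      then show ?thesis by (simp add: F1_def)
    qed
    moreover have "card X \<le> 3" if "odd n"
      using le aux(1,2,5) that calculation(1)[OF that] by (cases "N1 = {}") auto
    ultimately show ?thesis using le F F2 aux(1,2) by auto
  qed auto
  then show "card X \<le> 4" "odd n \<Longrightarrow> card X \<le> 3" "odd m \<Longrightarrow> odd n \<Longrightarrow> card X \<le> 2" by auto
qed

end

section \<open>Constructions on the torus\<close>

context cycle
begin

text \<open>No distance exceeds n/2, so a shortest path that has reached the antipode of its start
  has ended.\<close>

lemma geodesic_antipode:
  assumes "geodesic i j S" "x \<in> S" "2 * cyc_dist n i x = n"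
  shows "x = j"
proof -
  have "cyc_dist n i x + cyc_dist n x j \<le> cyc_dist n i j" using geodesic_between assms by blast
  then have "cyc_dist n x j = 0" using assms(3) dist_le[of i j] by linarith
  then show ?thesis using dist_eq_0 geodesic_ends[OF assms(1)] assms(2) by blast
qed

text \<open>The vertices from which some shortest path to 0 avoids 1 and some shortest path to 1
  avoids 0.\<close>

definition far :: "nat set" where
  "far = {(n + 1) div 2..n div 2 + 1}"

lemma farD: "r \<in> far \<Longrightarrow> 1 < r \<and> r < n \<and> n \<le> 2 * r \<and> 2 * (r - 1) \<le> n"
  using n4 by (auto simp: far_def)

text \<open>\<open>far\<close> is what lies opposite the edge \<open>{0, 1}\<close>: an edge for
  even \<open>n\<close>, a vertex for odd \<open>n\<close>.\<close>

lemma card_far: "card far = (if even n then 2 else 1)"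
  by (auto simp: far_def elim: evenE oddE)

lemma far_adj: "r \<in> far \<Longrightarrow> r' \<in> far \<Longrightarrow> r = r' \<or> adj r r'"
  using n4 by (auto simp: far_def adj_iff)

lemma geodesic_far:
  assumes "e \<in> {0, 1}" "r \<in> far"
  obtains T T' where "geodesic e r T" "geodesic e r T'" "T \<inter> far \<subseteq> {r}" "T' \<inter> {0, 1} \<subseteq> {e}"
proof -
  note r = farD[OF assms(2)]
  \<comment> \<open>Leave \<open>e\<close> in the direction away from the other end of the edge:
    \<open>0\<close> wraps around, \<open>1\<close> ascends.\<close>
  have low: "\<exists>T'. geodesic e r T' \<and> T' \<inter> {0, 1} \<subseteq> {e} \<and> T' \<subseteq> {0, 1} \<union> (if e = 0 then {r..<n} else {..r})"
  proof (cases "e = 0")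
    case True
    then show ?thesis using r geodesic_wrap[of 0 r] by (intro exI[of _ "{..0} \<union> {r..<n}"]) auto
  next
    case False
    then show ?thesis using r assms(1) geodesic_up[of 1 r] by (intro exI[of _ "{1..r}"]) auto
  qed
  \<comment> \<open>Arrive at \<open>r\<close> from the side away from the other opposite vertex:
    \<open>n div 2\<close> from below, \<open>n div 2 + 1\<close> from above.\<close>
  have high: "\<exists>T. geodesic e r T \<and> T \<inter> far \<subseteq> {r}"
  proof (cases "odd n")
    case True
    then have "card far = 1" by (simp add: card_far)
    then have "far = {r}" using assms(2) by (auto simp: card_1_singleton_iff)
    then show ?thesis using low by auto
  next
    case False
    then consider "r = n div 2" | "r = n div 2 + 1" using assms(2) by (fastforce simp: far_def)
    then show ?thesis
    proof cases
      case 1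
      then have "geodesic e r {e..r}" using False r assms(1) by (intro geodesic_up) auto
      moreover have "{e..r} \<inter> far \<subseteq> {r}" using 1 False by (auto simp: far_def)
      ultimately show ?thesis by blast
    next
      case 2
      then have "geodesic e r ({..e} \<union> {r..<n})"
        using False r assms(1) by (intro geodesic_wrap) (auto elim!: evenE)
      moreover have "1 < x \<and> x \<le> r" if "x \<in> far" for x using farD[OF that] that 2 by (simp add: far_def)
      then have "({..e} \<union> {r..<n}) \<inter> far \<subseteq> {r}" using assms(1) by fastforce
      ultimately show ?thesis by blast
    qed
  qed
  show thesis using low high that by blast
qed

lemma graph_iso_half_turn:
  assumes "n = 2 * h"
  shows "graph_iso (\<lambda>r. if r < h then r + h else r - h) (cycle_graph n) (cycle_graph n)" (is "graph_iso ?f _ _")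
proof -
  have "bij_betw ?f {0..<n} {0..<n}"
    by (rule bij_betw_byWitness[where f' = ?f]) (use assms in auto)
  moreover have "adj (?f x) (?f y) \<longleftrightarrow> adj x y" if "x < n" "y < n" for x y
    unfolding adj_iff using assms n4 that by (cases "x < h"; cases "y < h") auto
  ultimately show ?thesis unfolding graph_iso_def by simp
qed

end

text \<open>For a cycle of length 2h, \<open>g\<close> chooses one of the h antipodal pairs of rows
  for each of the first \<open>K\<close> columns.\<close>

definition antipodal_columns :: "nat \<Rightarrow> nat \<Rightarrow> (nat \<Rightarrow> nat) \<Rightarrow> (nat \<times> nat) set" where
  "antipodal_columns h K g = {(i, s). i < K \<and> (s = g i \<or> s = g i + h)}"

lemma card_antipodal_columns:
  assumes "0 < h"
  shows "card (antipodal_columns h K g) = 2 * K"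
proof -
  have "antipodal_columns h K g = Sigma {0..<K} (\<lambda>i. {g i, g i + h})"
    by (auto simp: antipodal_columns_def)
  moreover have "card {g i, g i + h} = 2" for i using assms by auto
  ultimately show ?thesis by (simp add: card_SigmaI)
qed

context torus
begin

lemma ftmv_setI:
  assumes "X \<subseteq> {0..<m} \<times> {0..<n}"
    and "\<And>i s j t. (i, s) \<in> X \<Longrightarrow> (j, t) \<in> X \<Longrightarrow> (i, s) \<noteq> (j, t) \<Longrightarrow>
      \<not> adjacent GH (i, s) (j, t) \<Longrightarrow> linked k GH X (i, s) (j, t)"
  shows "ftmv_set k GH X"
  unfolding ftmv_set_iff_linked
proof (intro conjI ballI impI)
  show "X \<subseteq> verts GH" using assms(1) by (simp add: verts_GH)
  fix u v assume "u \<in> X" "v \<in> X" "u \<noteq> v \<and> \<not> adjacent GH u v"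
  then show "linked k GH X u v" using assms(2) by (cases u, cases v) blast
qed

text \<open>An edge has no non-adjacent pair, so it satisfies the condition for every
  \<open>k\<close>.\<close>

lemma ftmv_edge:
  "\<exists>X. ftmv_set k GH X \<and> card X = 2"
proof -
  have "ftmv_set k GH {(0, 0), (1, 0)}"
    by (rule ftmv_setI) (use M.n4 N.n4 in \<open>auto simp: adjacent_torus M.adj_iff\<close>)
  then show ?thesis by (intro exI[of _ "{(0, 0), (1, 0)}"]) auto
qed

text \<open>Two antipodal columns carry an edge and what lies opposite to it. Non-adjacent pairs are
  then exactly those across the columns, where \<open>geodesic_far\<close> supplies the two column
  geodesics.\<close>

lemma ftmv_2_set:
  assumes "even m"
  shows "\<exists>X. ftmv_set 2 GH X \<and> card X = (if even n then 4 else 3)"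
proof -
  obtain h where h: "m = 2 * h" "2 \<le> h" using assms M.n4 by (auto elim: evenE)
  define X where "X = {0} \<times> {0, 1} \<union> {h} \<times> N.far"
  have lk: "linked 2 GH X (0, e) (h, r)" if er: "e \<in> {0, 1}" "r \<in> N.far" for e r
  proof -
    obtain T T' where T: "N.geodesic e r T" "N.geodesic e r T'" "T \<inter> N.far \<subseteq> {r}" "T' \<inter> {0, 1} \<subseteq> {e}"
      using N.geodesic_far[OF er] by blast
    note r = N.farD[OF er(2)]
    have "M.geodesic 0 h {0..h}" using h by (intro M.geodesic_up) auto
    \<comment> \<open>The second half runs 0, m - 1, ..., h, so the third path begins with the step
      to \<open>m - 1\<close>.\<close>
    moreover have "M.geodesic 0 h (insert 0 {h..<m})"
    proof -
      have "insert 0 {h..<m} = {..0} \<union> {h..<m}" by auto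
      then show ?thesis using h M.geodesic_wrap[of 0 h] by simp
    qed
    moreover have "M.geodesic (m - 1) h {h..<m}"
    proof -
      have "M.geodesic (m - 1) h {h..m - 1}" using h by (intro M.geodesic_down) auto
      moreover have "{h..m - 1} = {h..<m}" using h by auto
      ultimately show ?thesis by simp
    qed
    moreover have "M.adj 0 (m - 1)" unfolding M.adj_iff using h by auto
    moreover have "cyc_dist m 0 h = Suc (cyc_dist m (m - 1) h)" using h by (auto simp: cyc_dist_def)
    ultimately show ?thesis
    proof (rule linked_2_antipodal_rows[OF _ _ _ T(1,2)])
      have e: "e \<notin> N.far" "r \<noteq> 0" "r \<noteq> 1" using er r N.farD by fastforce+
      then show "e \<noteq> r" "(0, e) \<in> X" "(h, r) \<in> X" "fst ` X \<subseteq> {0, h}"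
        using er by (auto simp: X_def)
      show "x = 0" if "(x, e) \<in> X" for x using that e by (auto simp: X_def)
      show "x = h" if "(x, r) \<in> X" for x using that e by (auto simp: X_def)
      show "y = r" if "y \<in> T" "(h, y) \<in> X" for y using that T(3) h by (auto simp: X_def)
      show "y = e" if "y \<in> T'" "(0, y) \<in> X" for y using that T(4) h by (auto simp: X_def)
    qed (use h in auto)
  qed
  have "ftmv_set 2 GH X"
  proof (rule ftmv_setI)
    show "X \<subseteq> {0..<m} \<times> {0..<n}" using h N.n4 N.farD by (auto simp: X_def)
    fix i s j t assume X: "(i, s) \<in> X" "(j, t) \<in> X" "(i, s) \<noteq> (j, t)" "\<not> adjacent GH (i, s) (j, t)"
    have "N.adj 0 1" "N.adj 1 0" using N.n4 by (auto simp: N.adj_iff)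
    moreover have "0 < h" "h < m" using h by auto
    ultimately have "i = j \<Longrightarrow> adjacent GH (i, s) (j, t)"
      unfolding adjacent_torus using X(1-3) N.far_adj[of s t] unfolding X_def by auto
    with X(4) have "i \<noteq> j" by blast
    then consider "i = 0" "s \<in> {0, 1}" "j = h" "t \<in> N.far" | "i = h" "s \<in> N.far" "j = 0" "t \<in> {0, 1}"
      using X by (auto simp: X_def)
    then show "linked 2 GH X (i, s) (j, t)"
    proof cases
      case 1
      then show ?thesis using lk by blast
    next
      case 2
      have "0 < m" "h < m" "t < n" "s < n" using h N.n4 N.farD[OF 2(2)] 2(4) by auto
      then show ?thesis using P.linked_commute[OF lk[OF 2(4,2)]] 2(1,3) by (simp add: verts_GH)
    qed
  qed
  moreover have "card X = (if even n then 4 else 3)"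
  proof -
    have "finite N.far" by (simp add: N.far_def)
    then have "card X = card ({0 :: nat} \<times> {0, 1 :: nat}) + card ({h} \<times> N.far)"
      unfolding X_def using h by (intro card_Un_disjoint) auto
    then show ?thesis by (simp add: card_cartesian_product N.card_far)
  qed
  ultimately show ?thesis by blast
qed

section \<open>Constructions for k = 1\<close>

lemma ftmv_1_diagonal:
  assumes "m \<le> n"
  shows "\<exists>X. ftmv_set 1 GH X \<and> card X = m"
proof -
  \<comment> \<open>With one vertex in each occupied row and column, the boundary of a rectangle
    meets the set only in the two given corners.\<close>
  define X where "X = (\<lambda>i. (i, i)) ` {0..<m}"
  have "ftmv_set 1 GH X"
  proof (rule ftmv_setI)
    show "X \<subseteq> {0..<m} \<times> {0..<n}" using assms by (auto simp: X_def)
    fix i s j t assume X: "(i, s) \<in> X" "(j, t) \<in> X" "(i, s) \<noteq> (j, t)"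
    then have *: "s = i" "t = j" "i \<noteq> j" "i < m" "j < m" by (auto simp: X_def)
    obtain S where S: "M.geodesic i j S" using M.geodesic_exists[of i j] * by auto
    obtain T where T: "N.geodesic s t T" using N.geodesic_exists[of s t] * assms by auto
    show "linked 1 GH X (i, s) (j, t)"
      using * X by (intro linked_1_corners[OF S S T T]) (auto simp: X_def)
  qed
  moreover have "card X = m" unfolding X_def by (subst card_image) (auto simp: inj_on_def)
  ultimately show ?thesis by blast
qed

lemma linked_1_antipodal_column:
  assumes X: "i < m" "s < t" "t < n" "2 * (t - s) = n" "(i, s) \<in> X" "(i, t) \<in> X"
    "\<And>y. (i, y) \<in> X \<Longrightarrow> y = s \<or> y = t"
  shows "linked 1 GH X (i, s) (i, t)" "linked 1 GH X (i, t) (i, s)"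
proof -
  have "N.geodesic s t {s..t}" by (rule N.geodesic_up) (use X in simp_all)
  moreover have "N.geodesic s t ({..s} \<union> {t..<n})" by (rule N.geodesic_wrap) (use X in simp_all)
  ultimately have "P.geodesic (i, s) (i, t) ({i} \<times> {s..t})" "P.geodesic (i, s) (i, t) ({i} \<times> ({..s} \<union> {t..<n}))"
    using X(1) by (auto intro!: geodesic_column)
  then show "linked 1 GH X (i, s) (i, t)"
    by (rule P.linked_1I) (use X in auto)
  then show "linked 1 GH X (i, t) (i, s)"
    by (rule P.linked_commute) (use X in \<open>auto simp: verts_GH\<close>)
qed

lemma linked_1_antipodal_row:
  assumes X: "s < n" "i < j" "j < m" "2 * (j - i) = m" "(i, s) \<in> X" "(j, s) \<in> X"
    "\<And>x. (x, s) \<in> X \<Longrightarrow> x = i \<or> x = j"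
  shows "linked 1 GH X (i, s) (j, s)" "linked 1 GH X (j, s) (i, s)"
proof -
  have "M.geodesic i j {i..j}" by (rule M.geodesic_up) (use X in simp_all)
  moreover have "M.geodesic i j ({..i} \<union> {j..<m})" by (rule M.geodesic_wrap) (use X in simp_all)
  ultimately have "P.geodesic (i, s) (j, s) ({i..j} \<times> {s})" "P.geodesic (i, s) (j, s) (({..i} \<union> {j..<m}) \<times> {s})"
    using X(1) by (auto intro!: geodesic_row)
  then show "linked 1 GH X (i, s) (j, s)"
    by (rule P.linked_1I) (use X in auto)
  then show "linked 1 GH X (j, s) (i, s)"
    by (rule P.linked_commute) (use X in \<open>auto simp: verts_GH\<close>)
qed

text \<open>For \<open>g i \<noteq> g j\<close> the boundary paths work: another vertex of
  \<open>X\<close> in a row or column of an end is antipodal to that end there, so by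
  \<open>geodesic_antipode\<close> it could only be a corner of the rectangle, and the other two
  corners are not in \<open>X\<close>.\<close>

lemma linked_antipodal_columns:
  assumes h: "n = 2 * h" and K: "K \<le> m" and g: "\<And>i. i < K \<Longrightarrow> g i < h"
    and g_eq: "\<And>i j. i < K \<Longrightarrow> j < K \<Longrightarrow> g i = g j \<Longrightarrow> i = j \<or> 2 * cyc_dist m i j = m"
  defines "X \<equiv> antipodal_columns h K g"
  assumes X: "(i, s) \<in> X" "(j, t) \<in> X" "(i, s) \<noteq> (j, t)" and ij: "i = j \<or> g i \<noteq> g j"
  shows "linked 1 GH X (i, s) (j, t)"
proof (cases "i = j")
  case True
  have i: "i < K" "g i < h" using X(1) g by (auto simp: X_def antipodal_columns_def)
  have "linked 1 GH X (i, g i) (i, g i + h)" "linked 1 GH X (i, g i + h) (i, g i)"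
    by (rule linked_1_antipodal_column; use i K h in \<open>auto simp: X_def antipodal_columns_def\<close>)+
  then show ?thesis using X True by (auto simp: X_def antipodal_columns_def)
next
  case False
  have b: "i < K" "j < K" "s < n" "t < n" "g i < h" "g j < h"
    using X g[of i] g[of j] h by (auto simp: X_def antipodal_columns_def)
  have st: "s \<noteq> t" using X b ij False h by (auto simp: X_def antipodal_columns_def)
  obtain S where S: "M.geodesic i j S" using M.geodesic_exists[of i j] b K by auto
  obtain T where T: "N.geodesic s t T" using N.geodesic_exists[of s t] b by auto
  have row: "g x = g c" if "(x, r) \<in> X" "(c, r) \<in> X" for x c r
    using that g[of x] g[of c] h by (auto simp: X_def antipodal_columns_def)
  have col: "y = r \<or> 2 * cyc_dist n r y = n" if "(c, y) \<in> X" "(c, r) \<in> X" for c y r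
    using that g[of c] h by (auto simp: X_def antipodal_columns_def cyc_dist_def)
  have S_end: "x = i \<or> x = j" if "x \<in> S" "2 * cyc_dist m i x = m \<or> 2 * cyc_dist m j x = m" for x
    using M.geodesic_antipode[OF S that(1)] M.geodesic_antipode[OF M.geodesic_commute[OF S] that(1)] that(2)
    by blast
  have T_end: "y = s \<or> y = t" if "y \<in> T" "2 * cyc_dist n s y = n \<or> 2 * cyc_dist n t y = n" for y
    using N.geodesic_antipode[OF T that(1)] N.geodesic_antipode[OF N.geodesic_commute[OF T] that(1)] that(2)
    by blast
  have notX: "(j, s) \<notin> X" "(i, t) \<notin> X" using row X ij False by metis+
  have K_bd: "x < K" if "(x, y) \<in> X" for x y using that by (auto simp: X_def antipodal_columns_def)
  show ?thesis
  proof (rule linked_1_corners[OF S S T T False st X(1,2)])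
    show "x = i" if "x \<in> S" "(x, s) \<in> X" for x
      using S_end[OF that(1)] g_eq[of i x] row[OF X(1) that(2)] K_bd[OF that(2)] b(1) notX that by blast
    show "x = j" if "x \<in> S" "(x, t) \<in> X" for x
      using S_end[OF that(1)] g_eq[of j x] row[OF X(2) that(2)] K_bd[OF that(2)] b(2) notX that by blast
    show "y = t" if "y \<in> T" "(j, y) \<in> X" for y
      using T_end[OF that(1)] col[OF that(2) X(2)] notX that by blast
    show "y = s" if "y \<in> T" "(i, y) \<in> X" for y
      using T_end[OF that(1)] col[OF that(2) X(1)] notX that by blast
  qed
qed

lemma ftmv_1_antipodal:
  assumes "n = 2 * h" "K \<le> m" "K \<le> h"
  shows "\<exists>X. ftmv_set 1 GH X \<and> card X = 2 * K"
proof -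
  have "ftmv_set 1 GH (antipodal_columns h K (\<lambda>i. i))"
  proof (rule ftmv_setI)
    show "antipodal_columns h K (\<lambda>i. i) \<subseteq> {0..<m} \<times> {0..<n}"
      using assms by (auto simp: antipodal_columns_def)
  qed (rule linked_antipodal_columns; use assms in auto)
  moreover have "0 < h" using assms N.n4 by simp
  ultimately show ?thesis using card_antipodal_columns by blast
qed

text \<open>Both other corners of this rectangle are in \<open>X\<close>, so each path leaves the
  boundary one row early. Row \<open>i + 1\<close> is entered only at column \<open>i + 2\<close>
  because \<open>(i + 1, i + 1)\<close> may be in \<open>X\<close>; \<open>3 \<le> M\<close> keeps
  this column short of \<open>i + M\<close>. The second path is the image of the first under the
  point reflection of the rectangle.\<close>

lemma linked_1_box_diagonal:
  assumes m: "m = 2 * M" "3 \<le> M" and n: "n = 2 * H" "M \<le> H" and i: "i < M"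
  defines "X \<equiv> antipodal_columns H m (\<lambda>c. if c < M then c else c - M)"
  shows "linked 1 GH X (i, i) (i + M, i + H)"
proof -
  have b: "i + M < m" "i + H < n" "4 \<le> n" using m n i by auto
  have X: "(c, r) \<in> X \<longleftrightarrow> (if c < M then r = c \<or> r = c + H else c < m \<and> (r + M = c \<or> r + M = c + H))" for c r
    using m n unfolding X_def antipodal_columns_def by auto
  have d: "cyc_dist m i (i + 2) = 2" "cyc_dist n i (i + 1) = 1" "cyc_dist m (i + 2) (i + M) = M - 2"
    "cyc_dist n (i + 1) (i + H) = H - 1" "cyc_dist m i (i + (M - 2)) = M - 2"
    "cyc_dist n i (i + (H - 1)) = H - 1" "cyc_dist m (i + (M - 2)) (i + M) = 2"
    "cyc_dist n (i + (H - 1)) (i + H) = 1" "cyc_dist m i (i + M) = M" "cyc_dist n i (i + H) = H"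
    using m n by (simp_all add: cyc_dist_def)
  have P1: "P.geodesic (i, i) (i + M, i + H)
     (({i..i+2} \<times> {i} \<union> {i+2} \<times> {i..i+1}) \<union> ({i+2..i+M} \<times> {i+1} \<union> {i+M} \<times> {i+1..i+H}))"
  proof (rule P.geodesic_trans)
    show "P.geodesic (i, i) (i+2, i+1) ({i..i+2} \<times> {i} \<union> {i+2} \<times> {i..i+1})"
      by (rule geodesic_row_column[OF M.geodesic_up N.geodesic_up]) (use m n i in linarith)+
    show "P.geodesic (i+2, i+1) (i + M, i + H) ({i+2..i+M} \<times> {i+1} \<union> {i+M} \<times> {i+1..i+H})"
      by (rule geodesic_row_column[OF M.geodesic_up N.geodesic_up]) (use m n i in linarith)+
    show "pdist (i, i) (i + 2, i + 1) + pdist (i + 2, i + 1) (i + M, i + H) = pdist (i, i) (i + M, i + H)"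
      unfolding pdist_simp d using m n by linarith
  qed
  have P2: "P.geodesic (i, i) (i + M, i + H)
     (({i} \<times> {i..i+(H-1)} \<union> {i..i+(M-2)} \<times> {i+(H-1)}) \<union>
      ({i+(M-2)} \<times> {i+(H-1)..i+H} \<union> {i+(M-2)..i+M} \<times> {i+H}))"
  proof (rule P.geodesic_trans)
    show "P.geodesic (i, i) (i+(M-2), i+(H-1)) ({i} \<times> {i..i+(H-1)} \<union> {i..i+(M-2)} \<times> {i+(H-1)})"
      by (rule geodesic_column_row[OF M.geodesic_up N.geodesic_up]) (use m n i in linarith)+
    show "P.geodesic (i+(M-2), i+(H-1)) (i + M, i + H)
        ({i+(M-2)} \<times> {i+(H-1)..i+H} \<union> {i+(M-2)..i+M} \<times> {i+H})"
      by (rule geodesic_column_row[OF M.geodesic_up N.geodesic_up]) (use m n i in linarith)+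
    show "pdist (i, i) (i+(M-2), i+(H-1)) + pdist (i+(M-2), i+(H-1)) (i + M, i + H) = pdist (i, i) (i + M, i + H)"
      unfolding pdist_simp d using m n by linarith
  qed
  show ?thesis
  proof (rule P.linked_1I[OF P1 P2])
    show "(i, i) \<in> X" "(i + M, i + H) \<in> X" using i b by (auto simp: X)
  qed (use m n i in \<open>auto simp: X split: if_splits\<close>)
qed

text \<open>Here \<open>g\<close> is reduction modulo \<open>M\<close>, so \<open>X\<close> is a
  union of four-point boxes formed by two antipodal columns and two antipodal rows. Only the
  diagonals and horizontal sides of a box are not covered by
  \<open>linked_antipodal_columns\<close>.\<close>

lemma ftmv_1_even:
  assumes m: "m = 2 * M" "3 \<le> M" and n: "n = 2 * H" "M \<le> H"
  shows "\<exists>X. ftmv_set 1 GH X \<and> card X = 2 * m"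
proof -
  define g where "g c = (if c < M then c else c - M)" for c
  define X where "X = antipodal_columns H m g"
  have g: "g c < M" "c = g c \<or> c = g c + M" if "c < m" for c using that m by (auto simp: g_def)
  have X: "(c, r) \<in> X \<longleftrightarrow> c < m \<and> (r = g c \<or> r = g c + H)" for c r
    by (simp add: X_def antipodal_columns_def)
  have X_bd: "X \<subseteq> verts GH"
  proof
    fix w assume "w \<in> X"
    moreover obtain c r where "w = (c, r)" by (cases w)
    ultimately have "w = (c, r)" "c < m" "r < n" using X[of c r] g(1)[of c] n by auto
    then show "w \<in> verts GH" by (simp add: verts_GH)
  qed
  \<comment> \<open>The half turn of the second factor preserves \<open>X\<close> and exchanges the
    two diagonals of a box, so one diagonal suffices.\<close>
  define f where "f r = (if r < H then r + H else r - H)" for r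
  define \<phi> where "\<phi> = (\<lambda>(c :: nat, r). (c, f r))"
  have \<phi>: "graph_iso \<phi> GH GH"
    unfolding \<phi>_def f_def by (rule graph_iso_product[OF N.graph_iso_half_turn[OF n(1)]])
  have \<phi>X: "\<phi> w \<in> X \<and> \<phi> (\<phi> w) = w" if "w \<in> X" for w
  proof -
    obtain c r where w: "w = (c, r)" by (cases w)
    then have c: "c < m" "r = g c \<or> r = g c + H" using that X by auto
    then have "f r = (if r = g c then g c + H else g c)" "f (f r) = r"
      using g(1)[OF c(1)] n(2) by (auto simp: f_def)
    then show ?thesis using w c X[of c "f r"] by (auto simp: \<phi>_def)
  qed
  have \<phi>_image: "\<phi> ` X = X" using \<phi>X by (force simp: image_iff)
  have diag: "linked 1 GH X (a, s) (a + M, t)" "linked 1 GH X (a + M, t) (a, s)"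
    if a: "a < M" and X': "(a, s) \<in> X" "(a + M, t) \<in> X" "s \<noteq> t" for a s t
  proof -
    have "linked 1 GH X (a, a) (a + M, a + H)"
      using linked_1_box_diagonal[OF m n a] unfolding X_def g_def .
    moreover have aX: "(a, a) \<in> X" "(a + M, a + H) \<in> X" using a m X by (auto simp: g_def)
    ultimately have "linked 1 GH X (\<phi> (a, a)) (\<phi> (a + M, a + H))"
      using linked_iso[OF \<phi> X_bd, of "(a, a)" "(a + M, a + H)" 1] \<phi>_image by simp
    then have "linked 1 GH X (a, a + H) (a + M, a)" using a n by (simp add: \<phi>_def f_def)
    moreover have "s = a \<and> t = a + H \<or> s = a + H \<and> t = a" using X' a X m by (auto simp: g_def)
    ultimately show "linked 1 GH X (a, s) (a + M, t)"
      using \<open>linked 1 GH X (a, a) (a + M, a + H)\<close> by blast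
    then show "linked 1 GH X (a + M, t) (a, s)"
      by (rule P.linked_commute) (use X' X_bd in blast)+
  qed
  have row: "linked 1 GH X (a, s) (a + M, s)" "linked 1 GH X (a + M, s) (a, s)"
    if a: "a < M" and X': "(a, s) \<in> X" "(a + M, s) \<in> X" for a s
  proof -
    have "s < n" using X' X_bd by (auto simp: verts_GH)
    moreover have "x = a \<or> x = a + M" if x: "(x, s) \<in> X" for x
    proof -
      have "x < m" "s = g x \<or> s = g x + H" "s = a \<or> s = a + H" using x X'(1) X a by (auto simp: g_def)
      then show ?thesis using g[of x] a n(2) by auto
    qed
    ultimately show "linked 1 GH X (a, s) (a + M, s)" "linked 1 GH X (a + M, s) (a, s)"
      using linked_1_antipodal_row[of s a "a + M" X] X' a m by auto
  qed
  have "ftmv_set 1 GH X"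
  proof (rule ftmv_setI)
    show "X \<subseteq> {0..<m} \<times> {0..<n}" using X_bd by (simp add: verts_GH)
    fix i s j t assume ij: "(i, s) \<in> X" "(j, t) \<in> X" "(i, s) \<noteq> (j, t)"
    then have b: "i < m" "j < m" using X by auto
    show "linked 1 GH X (i, s) (j, t)"
    proof (cases "i = j \<or> g i \<noteq> g j")
      case True
      show ?thesis unfolding X_def
      proof (rule linked_antipodal_columns[OF n(1) order.refl])
        show "g c < H" if "c < m" for c using g(1)[OF that] n(2) by simp
        show "c = c' \<or> 2 * cyc_dist m c c' = m" if "c < m" "c' < m" "g c = g c'" for c c'
          using g(2)[OF that(1)] g(2)[OF that(2)] that M.antipode_iff[OF that(1,2)] m(1) by auto
      qed (use ij True X_def in auto)
    next
      case False
      define a where "a = g i"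
      have a: "a < M" "i = a \<or> i = a + M" "j = a \<or> j = a + M" "i \<noteq> j"
        using g[OF b(1)] g[OF b(2)] False by (auto simp: a_def)
      then consider "i = a" "j = a + M" | "i = a + M" "j = a" by blast
      then show ?thesis
      proof cases
        case 1
        then show ?thesis using diag(1)[OF a(1), of s t] row(1)[OF a(1), of s] ij by (cases "s = t") auto
      next
        case 2
        then show ?thesis using diag(2)[OF a(1), of t s] row(2)[OF a(1), of s] ij by (cases "s = t") auto
      qed
    qed
  qed
  moreover have "card X = 2 * m" unfolding X_def using n m by (intro card_antipodal_columns) auto
  ultimately show ?thesis by blast
qed

text \<open>In a cycle of length 4 antipodes have common neighbours. The whole change of the second
  coordinate is made in the column of such a neighbour \<open>a\<close>, which keeps the path off
  the columns \<open>i\<close> and \<open>j\<close> except at its ends.\<close>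

lemma geodesic_via:
  assumes "M.adj i a" "M.adj a j" "i \<noteq> j" "2 * cyc_dist m i j = m" "m = 4" "N.geodesic s t T"
  shows "P.geodesic (i, s) (j, t) ({(i, s)} \<union> ({a} \<times> T \<union> {(j, t)}))"
proof -
  have b: "i < m" "a < m" "j < m" "s < n" "t < n"
    using assms(1,2) N.geodesic_ends[OF assms(6)] by (auto simp: M.adj_iff)
  have d: "cyc_dist m i a = 1" "cyc_dist m a j = 1" "cyc_dist m i j = 2"
    using M.dist_1[of i a] M.dist_1[of a j] assms b by auto
  have aj: "M.geodesic i a {i, a}" "M.geodesic a j {a, j}"
    by (rule M.geodesic_edge; use assms(1,2) M.adj_irrefl in blast)+
  have 1: "P.geodesic (i, s) (a, s) ({i, a} \<times> {s})" using geodesic_row[OF aj(1)] b by simp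
  have 2: "P.geodesic (a, s) (j, t) ({a} \<times> T \<union> {a, j} \<times> {t})"
    by (rule geodesic_column_row[OF aj(2) assms(6)])
  have "P.geodesic (i, s) (j, t) ({i, a} \<times> {s} \<union> ({a} \<times> T \<union> {a, j} \<times> {t}))"
    using d N.dist_eq_0[of s s] b by (intro P.geodesic_trans[OF 1 2]) auto
  moreover have "{i, a} \<times> {s} \<union> ({a} \<times> T \<union> {a, j} \<times> {t}) = {(i, s)} \<union> ({a} \<times> T \<union> {(j, t)})"
    using N.geodesic_ends[OF assms(6)] by auto
  ultimately show ?thesis by simp
qed

text \<open>Columns of equal parity carry the same rows, so a pair in antipodal columns can be
  joined through the two columns of the other parity, which are free in the rows concerned. A pair
  in adjacent columns uses the boundary paths with geodesics from
  \<open>geodesic_far\<close>.\<close>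

lemma ftmv_1_four:
  assumes m: "m = 4"
  shows "\<exists>X. ftmv_set 1 GH X \<and> card X = (if even n then 8 else 6)"
proof -
  define X :: "(nat \<times> nat) set" where "X = {0, 2} \<times> {0, 1} \<union> {1, 3} \<times> N.far"
  have X: "(c, r) \<in> X \<longleftrightarrow> (c = 0 \<or> c = 2) \<and> (r = 0 \<or> r = 1) \<or> (c = 1 \<or> c = 3) \<and> r \<in> N.far" for c r
    by (auto simp: X_def)
  have lt: "0 < m" "1 < m" "2 < m" "3 < m" "0 < n" "1 < n" using m N.n4 by auto
  have X_bd: "X \<subseteq> verts GH" using lt N.farD by (auto simp: X_def verts_GH)
  have far: "0 \<notin> N.far" "1 \<notin> N.far" using N.farD by fastforce+
  have adj_even: "M.adj i j" "M.adj j i" if "i \<in> {0, 2}" "j \<in> {1, 3}" for i j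
    unfolding M.adj_iff using that m by auto
  have opposite: "linked 1 GH X (i, s) (j, t)"
    if ij: "i \<noteq> j" "{i, j, a, b} = {0, 1, 2, 3}" "M.adj i a" "M.adj a j" "M.adj i b" "M.adj b j"
      "2 * cyc_dist m i j = m" "a \<noteq> b"
      and X': "(i, s) \<in> X" "(j, t) \<in> X" "s = t \<or> N.adj s t"
      and blocked: "(a, s) \<notin> X" "(a, t) \<notin> X" "(b, s) \<notin> X" "(b, t) \<notin> X" for i j a b s t
  proof -
    have "s < n" using X' X_bd by (auto simp: verts_GH)
    then have T: "N.geodesic s t {s, t}"
      using X'(3) N.geodesic_edge N.geodesic_single N.adj_irrefl by (cases "s = t") auto
    have "i \<noteq> a" "j \<noteq> a" "i \<noteq> b" "j \<noteq> b" using ij M.adj_irrefl by blast+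
    then show ?thesis
      using X' blocked ij(8)
      by (intro P.linked_1I[OF geodesic_via[OF ij(3,4,1,7) m T] geodesic_via[OF ij(5,6,1,7) m T]]) auto
  qed
  have mixed: "linked 1 GH X (i, e) (j, r)" if ij: "i \<in> {0, 2}" "j \<in> {1, 3}" "e \<in> {0, 1}" "r \<in> N.far" for i j e r
  proof -
    obtain T T' where T: "N.geodesic e r T" "N.geodesic e r T'" "T \<inter> N.far \<subseteq> {r}" "T' \<inter> {0, 1} \<subseteq> {e}"
      using N.geodesic_far[OF ij(3,4)] by blast
    have "i \<noteq> j" "e \<noteq> r" using ij far by auto
    have S: "M.geodesic i j {i, j}" using adj_even(1)[OF ij(1,2)] \<open>i \<noteq> j\<close> by (rule M.geodesic_edge)
    show ?thesis
    proof (rule linked_1_corners[OF S S T(1,2) \<open>i \<noteq> j\<close> \<open>e \<noteq> r\<close>])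
      show "(i, e) \<in> X" "(j, r) \<in> X" using ij by (auto simp: X)
      show "x = i" if "x \<in> {i, j}" "(x, e) \<in> X" for x using that ij far by (auto simp: X)
      show "x = j" if "x \<in> {i, j}" "(x, r) \<in> X" for x using that ij far by (auto simp: X)
      show "y = r" if "y \<in> T" "(j, y) \<in> X" for y using that ij T(3) by (auto simp: X)
      show "y = e" if "y \<in> T'" "(i, y) \<in> X" for y using that ij T(4) by (auto simp: X)
    qed
  qed
  have adj01: "N.adj 0 1" "N.adj 1 0" using N.n4 by (auto simp: N.adj_iff)
  have "ftmv_set 1 GH X"
  proof (rule ftmv_setI)
    show "X \<subseteq> {0..<m} \<times> {0..<n}" using X_bd by (simp add: verts_GH)
    fix i s j t assume ij: "(i, s) \<in> X" "(j, t) \<in> X" "(i, s) \<noteq> (j, t)" "\<not> adjacent GH (i, s) (j, t)"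
    consider "i \<in> {0, 2}" "j \<in> {0, 2}" "s \<in> {0, 1}" "t \<in> {0, 1}"
      | "i \<in> {1, 3}" "j \<in> {1, 3}" "s \<in> N.far" "t \<in> N.far"
      | "i \<in> {0, 2}" "j \<in> {1, 3}" "s \<in> {0, 1}" "t \<in> N.far"
      | "j \<in> {0, 2}" "i \<in> {1, 3}" "t \<in> {0, 1}" "s \<in> N.far"
      using ij(1,2) X[of i s] X[of j t] by auto
    then show "linked 1 GH X (i, s) (j, t)"
    proof cases
      case 1
      then have st: "s = t \<or> N.adj s t" using adj01 by auto
      have "i < m" using 1 m by auto
      with ij(3,4) st have ne: "i \<noteq> j" by (auto simp: adjacent_torus)
      show ?thesis
      proof (rule opposite[OF ne _ _ _ _ _ _ _ ij(1,2) st, of 1 3])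
        show "2 * cyc_dist m i j = m" using 1 ne m by (auto simp: cyc_dist_def)
      qed (use 1 ne adj_even far in \<open>auto simp: X\<close>)
    next
      case 2
      then have st: "s = t \<or> N.adj s t" using N.far_adj by auto
      have "i < m" using 2 m by auto
      with ij(3,4) st have ne: "i \<noteq> j" by (auto simp: adjacent_torus)
      show ?thesis
      proof (rule opposite[OF ne _ _ _ _ _ _ _ ij(1,2) st, of 0 2])
        show "2 * cyc_dist m i j = m" using 2 ne m by (auto simp: cyc_dist_def)
        have "s \<noteq> 0" "s \<noteq> 1" "t \<noteq> 0" "t \<noteq> 1" using 2 far by metis+
        then show "(0, s) \<notin> X" "(0, t) \<notin> X" "(2, s) \<notin> X" "(2, t) \<notin> X" by (auto simp: X)
      qed (use 2 ne adj_even in auto)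
    next
      case 3
      then show ?thesis by (rule mixed)
    next
      case 4
      then show ?thesis using P.linked_commute[OF mixed[OF 4]] ij X_bd by blast
    qed
  qed
  moreover have "card X = (if even n then 8 else 6)"
  proof -
    have "finite N.far" by (simp add: N.far_def)
    then have "card X = card ({0, 2 :: nat} \<times> {0, 1 :: nat}) + card ({1, 3 :: nat} \<times> N.far)"
      unfolding X_def by (intro card_Un_disjoint) auto
    then show ?thesis by (simp add: card_cartesian_product N.card_far)
  qed
  ultimately show ?thesis by blast
qed

end

section \<open>Combining bounds and constructions by parity\<close>

theorem theorem6p5:
  fixes m n :: nat
  assumes "4 \<le> m" and "m \<le> n"
  shows "ftmv_number 1 (cartesian_product (cycle_graph m) (cycle_graph n)) =
           (if m = 4 \<and> odd n then 6
            else if 5 \<le> m \<and> odd n then m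
            else if odd m \<and> even n \<and> n < 2 * m then n
            else 2 * m)
       \<and> (\<forall>k::nat. 2 \<le> k \<longrightarrow>
           ftmv_number k (cartesian_product (cycle_graph m) (cycle_graph n)) =
             (if k = 2 \<and> even m \<and> even n then 4
              else if k = 2 \<and> (even m \<noteq> even n) then 3
              else if k = 2 \<and> odd m \<and> odd n then 2
              else 2))"
proof -
  have "4 \<le> n" using assms by simp
  with assms(1) interpret T: torus m n by unfold_locales
  have number_eq: "ftmv_number k T.GH = N"
    if "\<exists>X. ftmv_set k T.GH X \<and> card X = N" "\<And>Y. ftmv_set k T.GH Y \<Longrightarrow> card Y \<le> N" for k N
    using that ftmv_number_eqI by metis
  have swap_eq: "ftmv_number k T.GH = ftmv_number k T.swap.GH" for k by (rule ftmv_number_swap)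
  have "ftmv_number 1 T.GH = (if m = 4 \<and> odd n then 6
            else if 5 \<le> m \<and> odd n then m
            else if odd m \<and> even n \<and> n < 2 * m then n
            else 2 * m)"
  proof (cases "odd n")
    case True
    show ?thesis
    proof (cases "m = 4")
      case m4: True
      have "ftmv_number 1 T.GH = 6"
      proof (rule number_eq)
        show "card Y \<le> 6" if "ftmv_set 1 T.GH Y" for Y
          using T.ftmv_1_odd[OF that True] m4 by auto
      qed (use T.ftmv_1_four m4 True in auto)
      then show ?thesis using m4 True by simp
    next
      case m5: False
      have "ftmv_number 1 T.GH = m"
      proof (rule number_eq)
        show "card Y \<le> m" if Y: "ftmv_set 1 T.GH Y" for Y
        proof -
          \<comment> \<open>This absorbs the exceptional bound 6 into \<open>m\<close>; for odd
            \<open>m\<close> the exceptional bound is only 4.\<close>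
          have "even m \<Longrightarrow> 6 \<le> m" using m5 assms(1) by presburger
          then show ?thesis using T.ftmv_1_odd[OF Y True] assms(1) by auto
        qed
      qed (use T.ftmv_1_diagonal assms in auto)
      then show ?thesis using m5 True assms by simp
    qed
  next
    case n: False
    then obtain h where h: "n = 2 * h" by blast
    show ?thesis
    proof (cases "odd m \<and> n < 2 * m")
      case True
      have "ftmv_number 1 T.GH = n"
      proof (rule number_eq)
        show "\<exists>X. ftmv_set 1 T.GH X \<and> card X = n"
          using T.ftmv_1_antipodal[OF h, of h] h True by auto
        show "card Y \<le> n" if Y: "ftmv_set 1 T.GH Y" for Y
        proof -
          \<comment> \<open>The odd-cycle bound with \<open>m\<close> as the odd length, so
            \<open>n\<close> now counts the columns.\<close>
          have "card (prod.swap ` Y) \<le> n \<or> card (prod.swap ` Y) \<le> 6"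
            using T.swap.ftmv_1_odd[OF T.ftmv_set_swap[OF Y]] True by auto
          moreover have "6 \<le> n" using True n assms by presburger
          ultimately show ?thesis by (auto simp: card_image)
        qed
      qed
      then show ?thesis using True n by auto
    next
      case False
      have "ftmv_number 1 T.GH = 2 * m"
      proof (rule number_eq)
        show "\<exists>X. ftmv_set 1 T.GH X \<and> card X = 2 * m"
        proof (cases "even m")
          case True
          then obtain M where M: "m = 2 * M" by blast
          show ?thesis
          proof (cases "m = 4")
            case True
            then show ?thesis using T.ftmv_1_four n by auto
          next
            case False
            then show ?thesis using T.ftmv_1_even[OF M _ h] M h assms by auto
          qed
        next
          case odd: False
          \<comment> \<open>For odd \<open>m\<close> this is the case \<open>2 * m \<le> n\<close>,
            so there are enough antipodal pairs of rows to give each column its own.\<close>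
          then show ?thesis using T.ftmv_1_antipodal[OF h, of m] False h by auto
        qed
      qed (rule T.ftmv_1_le)
      then show ?thesis using False n by auto
    qed
  qed
  moreover have "ftmv_number k T.GH = (if k = 2 \<and> even m \<and> even n then 4
              else if k = 2 \<and> (even m \<noteq> even n) then 3
              else if k = 2 \<and> odd m \<and> odd n then 2
              else 2)" if k: "2 \<le> k" for k
  proof (cases "k = 2")
    case 2: True
    consider "even m" "even n" | "even m" "odd n" | "odd m" "even n" | "odd m" "odd n" by blast
    then show ?thesis
    proof cases
      case 1
      then have "ftmv_number 2 T.GH = 4"
        using T.ftmv_2_set T.ftmv_2_le(1) by (intro number_eq) auto
      then show ?thesis using 1 2 by simp
    next
      case 2
      then have "ftmv_number 2 T.GH = 3"
        using T.ftmv_2_set T.ftmv_2_le(2) by (intro number_eq) auto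
      then show ?thesis using 2 \<open>k = 2\<close> by simp
    next
      case 3
      \<comment> \<open>\<open>ftmv_2_set\<close> needs the first factor to be even, so the factors
        are exchanged.\<close>
      then obtain X where "ftmv_set 2 T.swap.GH X" "card X = 3"
        using T.swap.ftmv_2_set by auto
      then have "ftmv_number 2 T.swap.GH = 3"
        using T.swap.ftmv_2_le(2) 3 by (intro ftmv_number_eqI) auto
      then show ?thesis using 3 2 swap_eq[of 2] by simp
    next
      case 4
      then have "ftmv_number 2 T.GH = 2"
        using T.ftmv_edge T.ftmv_2_le(3) by (intro number_eq) auto
      then show ?thesis using 4 2 by simp
    qed
  next
    case False
    then have "ftmv_number k T.GH = 2"
      using T.ftmv_edge T.ftmv_ge_3_le k by (intro number_eq) auto
    then show ?thesis using False by simp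
  qed
  ultimately show ?thesis by blast
qed

end
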